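(* Let $p$ be a prime, let $G$ be an abelian $p$-group and let $L$ be a large subgroup of $G$. Then $G$ is summable if and only if $L$ is summable.
   Context: All groups are abelian and written additively. A subgroup $L$ of an abelian $p$-group $G$ is large if $L$ is fully invariant in $G$ (i.e. $f(L)\subseteq L$ for every endomorphism $f$ of $G$) and $G=L+B$ for every basic subgroup $B$ of $G$. For ordinals, $p^0G=G$, $p^{\alpha+1}G=p(p^\alpha G)$ and $p^\alpha G=\bigcap_{\beta<\alpha}p^\beta G$ for limit $\alpha$; the length of $G$ is the least ordinal $\lambda$ with $p^{\lambda}G=p^{\lambda+1}G$. $G[p]=\{g\in G: pg=0\}$. An abelian $p$-group $G$ of length $\lambda$ is summable if there are subgroups $G_\alpha$ ($\alpha<\lambda$) with $G[p]=\bigoplus_{\alpha<\lambda}G_\alpha$ and $G_\alpha\setminus\{0\}\subseteq p^\alpha G\setminus p^{\alpha+1}G$ for all $\alpha<\lambda$. *)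

theory Defs
  imports "HOL-Algebra.Algebra" "HOL-Computational_Algebra.Primes"
begin

section \<open>Ordinals\<close>

text \<open>
  The type below carries the initial well-order of cardinality \<open>2 ^ max(|'a|, aleph_0)\<close>.
  It thus represents all ordinals of cardinality at most \<open>max(|'a|, aleph_0)\<close>, and the
  lengths of all groups with carrier in \<open>'a\<close> are among them (see \<open>ex_ppow_stable\<close>).
\<close>

typedef 'a ordinal = "UNIV :: ('a + nat) set set"
  by simp

instantiation ordinal :: (type) wellorder
begin

definition less_eq_ordinal :: "'a ordinal \<Rightarrow> 'a ordinal \<Rightarrow> bool" where
  "\<alpha> \<le> \<beta> \<longleftrightarrow> (Rep_ordinal \<alpha>, Rep_ordinal \<beta>) \<in> |UNIV :: ('a + nat) set set|"

definition less_ordinal :: "'a ordinal \<Rightarrow> 'a ordinal \<Rightarrow> bool" where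
  "\<alpha> < \<beta> \<longleftrightarrow> \<alpha> \<le> \<beta> \<and> \<not> \<beta> \<le> (\<alpha> :: 'a ordinal)"

instance
proof
  let ?r = "|UNIV :: ('a + nat) set set|"
  have wo: "well_order_on UNIV ?r" by (rule card_of_well_order_on)
  then have lin: "refl_on UNIV ?r" "trans ?r" "antisym ?r" "total_on UNIV ?r" "wf (?r - Id)"
    by (auto simp: well_order_on_def linear_order_on_def partial_order_on_def preorder_on_def)
  fix x y z :: "'a ordinal"
  show "(x < y) = (x \<le> y \<and> \<not> y \<le> x)" by (rule less_ordinal_def)
  show "x \<le> x" using lin(1) by (simp add: less_eq_ordinal_def refl_on_def)
  show "x \<le> y \<Longrightarrow> y \<le> z \<Longrightarrow> x \<le> z"
    unfolding less_eq_ordinal_def using lin(2) by (meson transD)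
  show anti: "x \<le> y \<Longrightarrow> y \<le> x \<Longrightarrow> x = y" for x y :: "'a ordinal"
    unfolding less_eq_ordinal_def using lin(3) by (meson Rep_ordinal_inject antisymD)
  show "x \<le> y \<or> y \<le> x"
    unfolding less_eq_ordinal_def using lin(1,4)
    by (metis UNIV_I refl_onD total_on_def)
  fix P and a :: "'a ordinal"
  assume step: "\<And>x. (\<And>y. y < x \<Longrightarrow> P y) \<Longrightarrow> P (x :: 'a ordinal)"
  have "wf (inv_image (?r - Id) Rep_ordinal)" using lin(5) by (rule wf_inv_image)
  then show "P a"
  proof (induction a rule: wf_induct_rule)
    case (less x)
    show ?case
      by (rule step, rule less)
        (use anti in \<open>auto simp: in_inv_image less_ordinal_def less_eq_ordinal_def Rep_ordinal_inject\<close>)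
  qed
qed

end

instantiation ordinal :: (type) zero
begin
definition zero_ordinal :: "'a ordinal" where "(0 :: 'a ordinal) = (LEAST \<alpha>. True)"
instance ..
end

definition osuc :: "'a ordinal \<Rightarrow> 'a ordinal" where
  "osuc \<alpha> = (LEAST \<beta>. \<alpha> < \<beta>)"

definition is_limit :: "'a ordinal \<Rightarrow> bool" where
  "is_limit \<mu> \<longleftrightarrow> \<mu> \<noteq> 0 \<and> (\<forall>\<alpha>. \<mu> \<noteq> osuc \<alpha>)"

lemma zero_ordinal_le: "0 \<le> (\<alpha> :: 'a ordinal)"
  unfolding zero_ordinal_def by (rule Least_le) simp

lemma ex_greater_ordinal: "\<exists>\<beta>. \<alpha> < (\<beta> :: 'a ordinal)"
proof -
  let ?U = "UNIV :: ('a + nat) set set"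
  have "infinite ?U"
    by (simp add: Finite_Set.finite_set finite_Plus_UNIV_iff)
  then obtain b where b: "Rep_ordinal \<alpha> \<noteq> b" "(Rep_ordinal \<alpha>, b) \<in> |?U|"
    using infinite_Card_order_limit[OF card_of_Card_order, of ?U "Rep_ordinal \<alpha>"]
    by (auto simp: Field_card_of)
  then have "\<alpha> \<le> Abs_ordinal b" "\<alpha> \<noteq> Abs_ordinal b"
    by (auto simp: less_eq_ordinal_def Abs_ordinal_inverse)
  then show ?thesis by (metis order_le_less)
qed

lemma less_osuc: "\<alpha> < osuc \<alpha>"
  unfolding osuc_def by (rule LeastI_ex) (rule ex_greater_ordinal)

lemma osuc_le: "\<alpha> < \<beta> \<Longrightarrow> osuc \<alpha> \<le> \<beta>"
  unfolding osuc_def by (rule Least_le)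

lemma osuc_inject: "osuc \<alpha> = osuc \<beta> \<longleftrightarrow> \<alpha> = \<beta>"
  by (metis less_osuc linorder_neqE not_less osuc_le)

lemma osuc_neq_zero: "osuc \<alpha> \<noteq> 0"
  by (metis less_osuc not_less zero_ordinal_le)

section \<open>Abelian p-groups\<close>

text \<open>Groups are written multiplicatively, so \<open>n g\<close> becomes \<open>g [^] n\<close> and \<open>L + B\<close> becomes \<open>L <#> B\<close>.\<close>

definition abelian_p_group :: "nat \<Rightarrow> ('a, 'b) monoid_scheme \<Rightarrow> bool" where
  "abelian_p_group p G \<longleftrightarrow> comm_group G \<and> (\<forall>x\<in>carrier G. \<exists>n. group.ord G x = p ^ n)"

text \<open>
  \<open>D\<close> is the internal direct sum of the subgroups \<open>A i\<close>: the canonical map from the external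
  direct sum (finitely supported families) is an isomorphism onto \<open>D\<close>.
\<close>

definition internal_direct_sum ::
    "('a, 'b) monoid_scheme \<Rightarrow> 'i set \<Rightarrow> ('i \<Rightarrow> 'a set) \<Rightarrow> 'a set \<Rightarrow> bool" where
  "internal_direct_sum G I A D \<longleftrightarrow>
     (\<forall>i\<in>I. subgroup (A i) G) \<and>
     (\<lambda>x. gfinprod G x I) \<in> iso (sum_group I (\<lambda>i. G\<lparr>carrier := A i\<rparr>)) (G\<lparr>carrier := D\<rparr>)"

definition divisible_group :: "('a, 'b) monoid_scheme \<Rightarrow> bool" where
  "divisible_group G \<longleftrightarrow>
     (\<forall>n::nat. n > 0 \<longrightarrow> (\<forall>x\<in>carrier G. \<exists>y\<in>carrier G. y [^]\<^bsub>G\<^esub> n = x))"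

definition pure_subgroup :: "('a, 'b) monoid_scheme \<Rightarrow> 'a set \<Rightarrow> bool" where
  "pure_subgroup G B \<longleftrightarrow> subgroup B G \<and>
     (\<forall>n::nat. (\<lambda>x. x [^]\<^bsub>G\<^esub> n) ` carrier G \<inter> B = (\<lambda>x. x [^]\<^bsub>G\<^esub> n) ` B)"

definition direct_sum_of_cyclics :: "('a, 'b) monoid_scheme \<Rightarrow> 'a set \<Rightarrow> bool" where
  "direct_sum_of_cyclics G B \<longleftrightarrow>
     (\<exists>\<C>. (\<forall>C\<in>\<C>. cyclic_group (G\<lparr>carrier := C\<rparr>)) \<and> internal_direct_sum G \<C> (\<lambda>C. C) B)"

definition basic_subgroup :: "('a, 'b) monoid_scheme \<Rightarrow> 'a set \<Rightarrow> bool" where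
  "basic_subgroup G B \<longleftrightarrow>
     direct_sum_of_cyclics G B \<and> pure_subgroup G B \<and> divisible_group (G Mod B)"

definition fully_invariant :: "('a, 'b) monoid_scheme \<Rightarrow> 'a set \<Rightarrow> bool" where
  "fully_invariant G L \<longleftrightarrow> (\<forall>f\<in>hom G G. f ` L \<subseteq> L)"

definition large_subgroup :: "('a, 'b) monoid_scheme \<Rightarrow> 'a set \<Rightarrow> bool" where
  "large_subgroup G L \<longleftrightarrow> subgroup L G \<and> fully_invariant G L \<and>
     (\<forall>B. basic_subgroup G B \<longrightarrow> carrier G = L <#>\<^bsub>G\<^esub> B)"

section \<open>Length and summability\<close>

function ppow :: "nat \<Rightarrow> ('a, 'b) monoid_scheme \<Rightarrow> 'a ordinal \<Rightarrow> 'a set" where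
  "ppow p G 0 = carrier G"
| "ppow p G (osuc \<alpha>) = (\<lambda>x. x [^]\<^bsub>G\<^esub> p) ` ppow p G \<alpha>"
| "is_limit \<mu> \<Longrightarrow> ppow p G \<mu> = (\<Inter>\<beta>\<in>{..<\<mu>}. ppow p G \<beta>)"
  by (auto simp: is_limit_def osuc_inject osuc_neq_zero osuc_neq_zero[symmetric]) metis
termination
  by (relation "inv_image {(\<alpha>, \<beta>). \<alpha> < \<beta>} (\<lambda>(p, G, \<alpha>). \<alpha>)")
    (auto intro: wf less_osuc)

lemma ordinal_cases:
  obtains "\<alpha> = 0" | \<beta> where "\<alpha> = osuc \<beta>" | "is_limit \<alpha>"
  unfolding is_limit_def by blast

lemma ppow_osuc_subset:
  assumes "Group.monoid G"
  shows "ppow p G (osuc \<alpha>) \<subseteq> ppow p G \<alpha>"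
proof (induction \<alpha> rule: less_induct)
  case (less \<alpha>)
  interpret Group.monoid G by (rule assms)
  show ?case
  proof (cases \<alpha> rule: ordinal_cases)
    case 1
    then show ?thesis by auto
  next
    case (2 \<beta>)
    then show ?thesis using less[of \<beta>] less_osuc[of \<beta>] by auto
  next
    case 3
    have "y [^]\<^bsub>G\<^esub> p \<in> ppow p G \<beta>" if "y \<in> ppow p G \<alpha>" "\<beta> < \<alpha>" for y \<beta>
      using that less[of \<beta>] 3 by auto
    then show ?thesis using 3 by auto
  qed
qed

lemma ppow_antimono:
  assumes "Group.monoid G" and "\<alpha> \<le> \<beta>"
  shows "ppow p G \<beta> \<subseteq> ppow p G \<alpha>"
  using assms(2)
proof (induction \<beta> rule: less_induct)
  case (less \<beta>)
  show ?case
  proof (cases "\<alpha> = \<beta>")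
    case False
    then have lt: "\<alpha> < \<beta>" using less.prems by simp
    show ?thesis
    proof (cases \<beta> rule: ordinal_cases)
      case 1
      then show ?thesis using lt zero_ordinal_le[of \<alpha>] by simp
    next
      case (2 \<gamma>)
      then have "\<alpha> \<le> \<gamma>" using lt osuc_le[of \<gamma> \<alpha>] by (meson not_less)
      then show ?thesis
        using 2 less.IH[of \<gamma>] less_osuc[of \<gamma>] ppow_osuc_subset[OF assms(1), of p \<gamma>] by auto
    next
      case 3
      then show ?thesis using lt by auto
    qed
  qed simp
qed

text \<open>Hence the \<open>LEAST\<close> in the definition of \<open>group_length\<close> is attained.\<close>

lemma ex_ppow_stable:
  assumes "Group.monoid (G :: ('a, 'b) monoid_scheme)"
  shows "\<exists>\<mu>. ppow p G \<mu> = ppow p G (osuc \<mu>)"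
proof (rule ccontr)
  assume "\<not> ?thesis"
  then have "\<forall>\<alpha>. \<exists>x. x \<in> ppow p G \<alpha> - ppow p G (osuc \<alpha>)"
    using ppow_osuc_subset[OF assms] by blast
  then obtain f where f: "\<And>\<alpha>. f \<alpha> \<in> ppow p G \<alpha> - ppow p G (osuc \<alpha>)"
    by metis
  have "f \<alpha> \<noteq> f \<beta>" if "\<alpha> < \<beta>" for \<alpha> \<beta>
    using f[of \<alpha>] f[of \<beta>] ppow_antimono[OF assms osuc_le[OF that], of p] by auto
  then have "inj f" by (metis injI linorder_neqE)
  then have "inj (Inl \<circ> f \<circ> Abs_ordinal :: ('a + nat) set \<Rightarrow> 'a + nat)"
    by (intro inj_compose) (auto simp: inj_def Abs_ordinal_inject)
  then show False
    using Cantors_theorem[of "UNIV :: ('a + nat) set"] by (metis Pow_UNIV inj_imp_surj_inv surj_def)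
qed

definition group_length :: "nat \<Rightarrow> ('a, 'b) monoid_scheme \<Rightarrow> 'a ordinal" where
  "group_length p G = (LEAST \<mu>. ppow p G \<mu> = ppow p G (osuc \<mu>))"

definition p_socle :: "nat \<Rightarrow> ('a, 'b) monoid_scheme \<Rightarrow> 'a set" where
  "p_socle p G = {g \<in> carrier G. g [^]\<^bsub>G\<^esub> p = \<one>\<^bsub>G\<^esub>}"

definition summable_group :: "nat \<Rightarrow> ('a, 'b) monoid_scheme \<Rightarrow> bool" where
  "summable_group p G \<longleftrightarrow>
     (\<exists>S :: 'a ordinal \<Rightarrow> 'a set.
        internal_direct_sum G {..<group_length p G} S (p_socle p G) \<and>
        (\<forall>\<alpha><group_length p G. S \<alpha> - {\<one>\<^bsub>G\<^esub>} \<subseteq> ppow p G \<alpha> - ppow p G (osuc \<alpha>)))"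

end

(*
  Summability only concerns the socle V = G[p] filtered by V_a = (p^a G)[p]: it asks for subgroups
  S_a of V_a meeting V_(a+1) trivially whose sum is V; looking at the least index with a non-zero
  component shows that such a sum is automatically direct. For a large subgroup L one has
  (p^k L)[p] = (p^(u k) G)[p] for a nondecreasing u with k <= u k < omega, and p^a L = p^a G for
  a >= omega. Hence the filtrations of L[p] and G[p] differ only by merging finite blocks of finite
  indices, and decompositions are transferred by summing over blocks, respectively by splitting
  them with complements of F_p-vector spaces.

  Let M be fully invariant. A socle element s = p^n c of height n makes <c> a direct summand, and
  endomorphisms sending c to a given element show that M[p] is some (p^u G)[p] or consists of
  elements of infinite height. The second alternative for M = p^k L, with G[p] unbounded, is refuted
  by largeness: M is then contained in p^omega G, hence in a pure K with G/K quasicyclic and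
  p^n G not in K for all n. As G/K is divisible, K contains a basic subgroup of G, so G = L + K and
  p^k G lies in K, a contradiction.
*)
theory Submission
  imports Defs
begin

section \<open>Internal direct sums\<close>

lemma (in group) subgroup_nat_pow_closed:
  assumes "subgroup H G" "x \<in> H"
  shows "x [^] (n::nat) \<in> H"
  using assms by (induction n) (auto intro: subgroup.one_closed subgroup.m_closed)

lemma (in comm_group) subgroup_finprod_closed:
  assumes "subgroup H G" "\<And>i. i \<in> F \<Longrightarrow> f i \<in> H"
  shows "finprod G f F \<in> H"
  using assms(2)
proof (induction F rule: infinite_finite_induct)
  case (insert i F)
  have "f \<in> F \<rightarrow> carrier G" "f i \<in> carrier G"
    using insert.prems subgroup.mem_carrier[OF assms(1)] by auto
  then show ?case
    using insert by (simp add: subgroup.m_closed[OF assms(1)])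
qed (auto intro: subgroup.one_closed[OF assms(1)])

lemma (in comm_group) generate_Union_eq_finprods:
  assumes "\<And>i. i \<in> I \<Longrightarrow> subgroup (A i) G"
  shows "generate G (\<Union>i\<in>I. A i) =
    {finprod G f F |F f. finite F \<and> F \<subseteq> I \<and> (\<forall>i\<in>F. f i \<in> A i)}" (is "?L = ?R")
proof
  have car: "A i \<subseteq> carrier G" if "i \<in> I" for i
    using assms that by (simp add: subgroup.subset)
  have sing: "x \<in> ?R" if "x \<in> A i" "i \<in> I" for x i
  proof -
    have "x \<in> carrier G" using that car by blast
    then have "x = finprod G (\<lambda>_. x) {i}" by simp
    then show ?thesis using that by blast
  qed
  show "?L \<subseteq> ?R"
  proof
    fix x assume "x \<in> ?L"
    then show "x \<in> ?R"
    proof induction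
      case one
      show ?case by (intro CollectI exI[of _ "{}"]) simp
    next
      case (incl h)
      then show ?case using sing by blast
    next
      case (inv h)
      then show ?case using sing assms subgroup.m_inv_closed by (metis (lifting) UN_E)
    next
      case (eng h1 h2)
      then obtain F f F' f' where
        F: "finite F" "F \<subseteq> I" "\<forall>i\<in>F. f i \<in> A i" "h1 = finprod G f F" and
        F': "finite F'" "F' \<subseteq> I" "\<forall>i\<in>F'. f' i \<in> A i" "h2 = finprod G f' F'" by blast
      define g where "g i = (if i \<in> F then f i else \<one>)" for i
      define g' where "g' i = (if i \<in> F' then f' i else \<one>)" for i
      have gA: "g i \<in> A i" "g' i \<in> A i" if "i \<in> F \<union> F'" for i
        using that F F' assms[THEN subgroup.one_closed] by (auto simp: g_def g'_def)
      then have gc: "g \<in> F \<union> F' \<rightarrow> carrier G" "g' \<in> F \<union> F' \<rightarrow> carrier G"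
        using F(2) F'(2) car by blast+
      have "h1 = finprod G g (F \<union> F')" unfolding F(4)
        using F F' gc by (intro finprod_mono_neutral_cong_left) (auto simp: g_def)
      moreover have "h2 = finprod G g' (F \<union> F')" unfolding F'(4)
        using F F' gc by (intro finprod_mono_neutral_cong_left) (auto simp: g'_def)
      ultimately have "h1 \<otimes> h2 = finprod G (\<lambda>i. g i \<otimes> g' i) (F \<union> F')"
        using gc by simp
      moreover have "g i \<otimes> g' i \<in> A i" if "i \<in> F \<union> F'" for i
      proof -
        have "i \<in> I" using that F(2) F'(2) by blast
        then show ?thesis using subgroup.m_closed[OF assms gA[OF that]] by blast
      qed
      ultimately show ?case
        using F(1,2) F'(1,2) by (intro CollectI exI[of _ "F \<union> F'"] exI[of _ "\<lambda>i. g i \<otimes> g' i"]) auto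
    qed
  qed
  have "subgroup ?L G" using car by (intro generate_is_subgroup) blast
  then show "?R \<subseteq> ?L"
    by (auto intro!: subgroup_finprod_closed intro: generate.incl)
qed

lemma (in comm_group) generate_UnionE:
  assumes "\<And>i. i \<in> I \<Longrightarrow> subgroup (A i) G" "x \<in> generate G (\<Union>i\<in>I. A i)"
  obtains F f where "finite F" "F \<subseteq> I" "\<forall>i\<in>F. f i \<in> A i" "x = finprod G f F"
proof -
  have "x \<in> {finprod G f F |F f. finite F \<and> F \<subseteq> I \<and> (\<forall>i\<in>F. f i \<in> A i)}"
    using assms(2) generate_Union_eq_finprods[of I A, OF assms(1)] by simp
  then show ?thesis by (elim CollectE exE conjE) (rule that)
qed

lemma (in comm_group) internal_direct_sum_iff:
  "internal_direct_sum G I A D \<longleftrightarrow>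
    (\<forall>i\<in>I. subgroup (A i) G) \<and> D = generate G (\<Union>i\<in>I. A i) \<and>
    (\<forall>F f. finite F \<longrightarrow> F \<subseteq> I \<longrightarrow> (\<forall>i\<in>F. f i \<in> A i) \<longrightarrow> finprod G f F = \<one> \<longrightarrow>
       (\<forall>i\<in>F. f i = \<one>))"
proof (cases "\<forall>i\<in>I. subgroup (A i) G")
  case True
  let ?S = "sum_group I (\<lambda>i. G\<lparr>carrier := A i\<rparr>)"
  define h where "h = (\<lambda>x. gfinprod G x I)"
  define C where "C = carrier ?S"
  have sub: "subgroup (A i) G" if "i \<in> I" for i using True that by simp
  have car: "A i \<subseteq> carrier G" if "i \<in> I" for i
    using sub that by (simp add: subgroup.subset)
  have grp: "group (G\<lparr>carrier := A i\<rparr>)" if "i \<in> I" for i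
    using sub[OF that] by (rule subgroup_imp_group)
  have carS: "C = {x \<in> \<Pi>\<^sub>E i\<in>I. A i. finite {i \<in> I. x i \<noteq> \<one>}}"
    using grp by (simp add: C_def carrier_sum_group)
  have hom: "h \<in> hom ?S G"
    using hom_group_sum[of I "\<lambda>_ x. x" "\<lambda>i. G\<lparr>carrier := A i\<rparr>"] grp car by (auto simp: h_def hom_def)
  interpret hom: group_hom ?S G h
    using hom grp by (auto simp: group_hom_def group_hom_axioms_def is_group)
  have rep: "\<exists>x\<in>C. h x = finprod G f F \<and> (\<forall>i\<in>F. x i = f i)"
    if "finite F" "F \<subseteq> I" "\<forall>i\<in>F. f i \<in> A i" for F f
  proof -
    define x where "x = restrict (\<lambda>i. if i \<in> F then f i else \<one>) I"
    have supp: "{i \<in> I. x i \<noteq> \<one>} \<subseteq> F" by (auto simp: x_def)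
    have x: "x \<in> C"
      using that finite_subset[OF supp] sub[THEN subgroup.one_closed] by (auto simp: carS x_def)
    have "f \<in> F \<rightarrow> carrier G" using that car by blast
    moreover have "f i = \<one>" if "i \<in> F - {i \<in> I. x i \<noteq> \<one>}" for i
      using that \<open>F \<subseteq> I\<close> by (auto simp: x_def)
    moreover have "x i = f i" if "x i \<noteq> \<one>" "i \<in> I" for i
      using that by (auto simp: x_def split: if_splits)
    ultimately have "h x = finprod G f F"
      using supp finite_subset[OF supp] that(1)
      by (auto simp: h_def gfinprod_def intro!: finprod_mono_neutral_cong_left)
    moreover have "\<forall>i\<in>F. x i = f i" using that(2) by (auto simp: x_def)
    ultimately show ?thesis using x by (intro bexI[of _ x] conjI)
  qed
  have supp: "finite {i \<in> I. x i \<noteq> \<one>}" "\<forall>i\<in>{i \<in> I. x i \<noteq> \<one>}. x i \<in> A i"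
      "h x = finprod G x {i \<in> I. x i \<noteq> \<one>}" if "x \<in> C" for x
    using that by (auto simp: carS h_def gfinprod_def)
  have gen: "generate G (\<Union>i\<in>I. A i) =
      {finprod G f F |F f. finite F \<and> F \<subseteq> I \<and> (\<forall>i\<in>F. f i \<in> A i)}"
    by (rule generate_Union_eq_finprods) (rule sub)
  have im: "h ` C = generate G (\<Union>i\<in>I. A i)"
    unfolding gen
  proof (intro equalityI subsetI)
    fix y assume "y \<in> h ` C"
    then obtain x where x: "x \<in> C" "y = h x" by blast
    show "y \<in> {finprod G f F |F f. finite F \<and> F \<subseteq> I \<and> (\<forall>i\<in>F. f i \<in> A i)}"
      unfolding x(2) supp(3)[OF x(1)] using supp(1,2)[OF x(1)]
      by (intro CollectI exI[of _ x] exI[of _ "{i \<in> I. x i \<noteq> \<one>}"]) auto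
  next
    fix y assume "y \<in> {finprod G f F |F f. finite F \<and> F \<subseteq> I \<and> (\<forall>i\<in>F. f i \<in> A i)}"
    then obtain F f where y: "y = finprod G f F" and F: "finite F" "F \<subseteq> I" "\<forall>i\<in>F. f i \<in> A i" by blast
    obtain x where "x \<in> C" "h x = finprod G f F" using rep[OF F] by metis
    then show "y \<in> h ` C" unfolding y by (metis imageI)
  qed
  have inj: "inj_on h C \<longleftrightarrow> (\<forall>F f. finite F \<longrightarrow> F \<subseteq> I \<longrightarrow> (\<forall>i\<in>F. f i \<in> A i) \<longrightarrow>
       finprod G f F = \<one> \<longrightarrow> (\<forall>i\<in>F. f i = \<one>))" (is "_ \<longleftrightarrow> ?ind")
    unfolding hom.inj_on_one_iff[folded C_def]
  proof
    assume triv: "\<forall>x. x \<in> C \<longrightarrow> h x = \<one> \<longrightarrow> x = \<one>\<^bsub>?S\<^esub>"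
    show ?ind
    proof (intro allI impI)
      fix F f assume F: "finite F" "F \<subseteq> I" "\<forall>i\<in>F. f i \<in> A i" "finprod G f F = \<one>"
      obtain x where x: "x \<in> C" "h x = finprod G f F" "\<forall>i\<in>F. x i = f i"
        using rep[OF F(1-3)] by metis
      then have "x = \<one>\<^bsub>?S\<^esub>" using triv F(4) by simp
      then have "x i = \<one>" if "i \<in> F" for i using F(2) that by auto
      then show "\<forall>i\<in>F. f i = \<one>" using x(3) by simp
    qed
  next
    assume ind: ?ind
    show "\<forall>x. x \<in> C \<longrightarrow> h x = \<one> \<longrightarrow> x = \<one>\<^bsub>?S\<^esub>"
    proof (intro allI impI)
      fix x assume x: "x \<in> C" "h x = \<one>"
      have "finprod G x {i \<in> I. x i \<noteq> \<one>} = \<one>"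
        using supp(3)[OF x(1)] x(2) by simp
      with supp(1,2)[OF x(1)] have "\<forall>i\<in>{i \<in> I. x i \<noteq> \<one>}. x i = \<one>"
        by (intro ind[THEN spec, THEN spec, THEN mp, THEN mp, THEN mp, THEN mp]) auto
      then show "x = \<one>\<^bsub>?S\<^esub>" using x(1) unfolding carS by (intro ext) (auto simp: PiE_iff extensional_def)
    qed
  qed
  have "h \<in> iso ?S (G\<lparr>carrier := D\<rparr>) \<longleftrightarrow> h ` C = D \<and> inj_on h C"
    using hom by (auto simp: C_def iso_def bij_betw_def hom_def)
  then have *: "internal_direct_sum G I A D \<longleftrightarrow> h ` C = D \<and> inj_on h C"
    using True by (simp add: internal_direct_sum_def h_def)
  show ?thesis
    unfolding *[unfolded im inj] using True
    by (intro iffI; elim conjE; intro conjI) (assumption | rule sym)+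
qed (auto simp: internal_direct_sum_def)

section \<open>Maximal disjoint subgroups\<close>

lemma (in group) subgroup_coprime_pow:
  assumes "subgroup Q G" "x \<in> carrier G" "x [^] (t::int) \<in> Q" "x [^] (m::int) \<in> Q" "coprime t m"
  shows "x \<in> Q"
proof -
  obtain a b where "a * t + b * m = 1"
    using bezout_int[of t m] assms(5) by auto
  then have "x = x [^] (t * a + m * b)"
    using assms(2) by (simp add: mult.commute)
  also have "\<dots> = (x [^] t) [^] a \<otimes> (x [^] m) [^] b"
    using assms(2) by (simp add: int_pow_mult int_pow_pow)
  also have "\<dots> \<in> Q"
    using subgroup_int_pow_closed[OF assms(1,3)] subgroup_int_pow_closed[OF assms(1,4)]
      subgroup.m_closed[OF assms(1)] by blast
  finally show ?thesis .
qed

lemma (in group) subgroup_prime_pow_dvd: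
  assumes "subgroup Q G" "x \<in> carrier G" "x \<notin> Q" "x [^] (t::int) \<in> Q" "x [^] (p::nat) \<in> Q"
    "Factorial_Ring.prime p"
  shows "int p dvd t"
proof (rule ccontr)
  assume "\<not> int p dvd t"
  then have "coprime t (int p)"
    using assms(6) by (metis coprime_commute prime_imp_coprime prime_nat_int_transfer)
  then show False
    using subgroup_coprime_pow[OF assms(1,2,4), of "int p"] assms(3,5) by (simp add: int_pow_int)
qed

lemma (in comm_group) set_mult_subset_left:
  "subgroup A G \<Longrightarrow> subgroup B G \<Longrightarrow> A \<subseteq> A <#> B"
  unfolding set_mult_def
  by (force dest: subgroup.one_closed subgroup.mem_carrier)

lemma (in comm_group) set_mult_subset_right:
  "subgroup A G \<Longrightarrow> subgroup B G \<Longrightarrow> B \<subseteq> A <#> B"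
  unfolding set_mult_def
  by (force dest: subgroup.one_closed subgroup.mem_carrier)

lemma (in comm_group) set_multI: "a \<in> A \<Longrightarrow> b \<in> B \<Longrightarrow> a \<otimes> b \<in> A <#> B"
  unfolding set_mult_def by blast

lemma (in comm_group) set_multE:
  assumes "x \<in> A <#> B" obtains a b where "a \<in> A" "b \<in> B" "x = a \<otimes> b"
  using assms unfolding set_mult_def by blast

lemma (in group) subgroup_inv_mult_mem:
  assumes "subgroup H G" "a \<in> H" "x \<in> carrier G" "a \<otimes> x \<in> H"
  shows "x \<in> H"
proof -
  have "x = inv a \<otimes> (a \<otimes> x)"
    using assms by (simp add: m_assoc[symmetric] subgroup.mem_carrier)
  then show ?thesis using assms by (metis subgroup.m_closed subgroup.m_inv_closed)
qed

lemma (in comm_group) ex_maximal_disjoint_subgroup: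
  assumes p: "Factorial_Ring.prime p" and U: "subgroup U G" and A: "subgroup A G"
    and UA: "U \<inter> A \<subseteq> {\<one>}"
  obtains K where "subgroup K G" "U \<subseteq> K" "K \<inter> A \<subseteq> {\<one>}"
    "\<forall>x\<in>carrier G. x [^] (p::nat) \<in> K \<longrightarrow> x \<in> A <#> K"
proof -
  define \<F> where "\<F> = {K. subgroup K G \<and> U \<subseteq> K \<and> K \<inter> A \<subseteq> {\<one>}}"
  have ex: "\<exists>M\<in>\<F>. \<forall>H\<in>\<F>. M \<subseteq> H \<longrightarrow> H = M"
  proof (rule subset_Zorn_nonempty)
    show "\<F> \<noteq> {}" using U UA by (auto simp: \<F>_def)
    fix \<C> assume \<C>: "\<C> \<noteq> {}" "subset.chain \<F> \<C>"
    then have mem: "\<And>H. H \<in> \<C> \<Longrightarrow> H \<in> \<F>" and ch: "\<And>H N. H \<in> \<C> \<Longrightarrow> N \<in> \<C> \<Longrightarrow> H \<subseteq> N \<or> N \<subseteq> H"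
      by (auto simp: subset.chain_def)
    have sub: "subgroup H G" "U \<subseteq> H" "H \<inter> A \<subseteq> {\<one>}" if "H \<in> \<C>" for H
      using mem[OF that] by (simp_all add: \<F>_def)
    obtain H0 where H0: "H0 \<in> \<C>" using \<C>(1) by blast
    have "subgroup (\<Union>\<C>) G"
    proof (rule subgroupI)
      show "\<Union>\<C> \<subseteq> carrier G" using sub(1)[THEN subgroup.subset] by blast
      show "\<Union>\<C> \<noteq> {}" using H0 sub(1)[OF H0, THEN subgroup.one_closed] by blast
      show "inv x \<in> \<Union>\<C>" if "x \<in> \<Union>\<C>" for x
        using that sub(1)[THEN subgroup.m_inv_closed] by blast
      fix x y assume "x \<in> \<Union>\<C>" "y \<in> \<Union>\<C>"
      then obtain H where H: "H \<in> \<C>" "x \<in> H" "y \<in> H" using ch by blast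
      then have "x \<otimes> y \<in> H" by (intro subgroup.m_closed[OF sub(1)])
      then show "x \<otimes> y \<in> \<Union>\<C>" using H(1) by blast
    qed
    then show "\<Union>\<C> \<in> \<F>" using sub(2)[OF H0] H0 sub(3) unfolding \<F>_def by blast
  qed
  then obtain K where K: "subgroup K G" "U \<subseteq> K" "K \<inter> A \<subseteq> {\<one>}"
    and max: "\<And>H. subgroup H G \<Longrightarrow> H \<inter> A \<subseteq> {\<one>} \<Longrightarrow> K \<subseteq> H \<Longrightarrow> H = K"
    unfolding \<F>_def by (auto 0 4)
  have AK: "subgroup (A <#> K) G" using A K by (intro mult_subgroups)
  have "x \<in> A <#> K" if x: "x \<in> carrier G" "x [^] p \<in> K" for x
  proof (cases "x \<in> K")
    case True
    then show ?thesis using set_mult_subset_right[OF A K(1)] by blast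
  next
    case False
    let ?H = "K <#> generate G {x}"
    have gx: "subgroup (generate G {x}) G" using x by (intro generate_is_subgroup) simp
    have "x \<in> ?H" using set_mult_subset_right[OF K(1) gx] generate.incl[of x "{x}"] by blast
    moreover have "subgroup ?H G" "K \<subseteq> ?H"
      using K(1) gx by (simp_all add: mult_subgroups set_mult_subset_left)
    ultimately have "\<not> ?H \<inter> A \<subseteq> {\<one>}" using max False by blast
    then obtain k t a where a: "a \<in> A" "a \<noteq> \<one>" "k \<in> K" "a = k \<otimes> x [^] (t::int)"
      using x generate_pow[of x] by (auto elim!: set_multE)
    have kc: "k \<in> carrier G" "a \<in> carrier G"
      using a K A subgroup.mem_carrier by fast+
    have "\<not> int p dvd t"
    proof
      assume "int p dvd t"
      then obtain r where "t = int p * r" by blast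
      then have "x [^] t = (x [^] p) [^] r" using x by (simp add: int_pow_pow[symmetric] int_pow_int)
      then have "x [^] t \<in> K" using subgroup_int_pow_closed[OF K(1) x(2)] by simp
      then have "a \<in> K" using a K(1) by (simp add: subgroup.m_closed)
      then show False using K(3) a by blast
    qed
    moreover have "x [^] t \<in> A <#> K"
    proof (rule subgroup_inv_mult_mem[OF AK])
      show "k \<in> A <#> K" using a(3) set_mult_subset_right[OF A K(1)] by blast
      show "k \<otimes> x [^] t \<in> A <#> K" using a(1,4) set_mult_subset_left[OF A K(1)] by blast
    qed (use x in simp)
    moreover have "x [^] p \<in> A <#> K"
      using x set_mult_subset_right[OF A K(1)] by blast
    ultimately show ?thesis
      using subgroup_prime_pow_dvd[OF AK x(1) _ _ _ p] by blast
  qed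
  then show ?thesis using that K by blast
qed

lemma (in comm_group) elementary_complement:
  assumes p: "Factorial_Ring.prime (p::nat)" and A: "subgroup A G" and B: "subgroup B G" and "A \<subseteq> B"
    and exp: "\<And>x. x \<in> B \<Longrightarrow> x [^] p = \<one>"
  obtains C where "subgroup C G" "C \<subseteq> B" "A \<inter> C \<subseteq> {\<one>}" "B \<subseteq> A <#> C"
proof -
  have one: "subgroup {\<one>} G" by (rule triv_subgroup)
  obtain K where K: "subgroup K G" "{\<one>} \<subseteq> K" "K \<inter> A \<subseteq> {\<one>}"
    "\<forall>x\<in>carrier G. x [^] p \<in> K \<longrightarrow> x \<in> A <#> K"
    using ex_maximal_disjoint_subgroup[OF p one A Int_lower1] by metis
  have "B \<subseteq> A <#> (K \<inter> B)"
  proof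
    fix x assume x: "x \<in> B"
    then have "x \<in> A <#> K"
      using K(4) exp[OF x] subgroup.one_closed[OF K(1)] subgroup.mem_carrier[OF B] by simp
    then obtain a k where ak: "a \<in> A" "k \<in> K" "x = a \<otimes> k" by (rule set_multE)
    then have "k \<in> B"
      using subgroup_inv_mult_mem[OF B, of a k] x \<open>A \<subseteq> B\<close> subgroup.mem_carrier[OF K(1)] by auto
    then show "x \<in> A <#> (K \<inter> B)" using ak by (auto intro: set_multI)
  qed
  then show ?thesis
    using that[of "K \<inter> B"] K subgroups_Inter_pair[OF K(1) B] by blast
qed

section \<open>Finite and infinite ordinals\<close>

definition ofin :: "nat \<Rightarrow> 'a ordinal" where
  "ofin n = (osuc ^^ n) 0"

lemma ofin_0: "ofin 0 = 0" and ofin_Suc: "ofin (Suc n) = osuc (ofin n)"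
  by (simp_all add: ofin_def)

lemma strict_mono_ofin: "strict_mono ofin"
  by (simp add: strict_mono_Suc_iff ofin_Suc less_osuc)

lemma the_inv_ofin: "the_inv ofin (ofin n) = n"
  by (rule the_inv_f_f) (rule strict_mono_imp_inj_on[OF strict_mono_ofin])

lemma ofin_less_infinite:
  assumes "\<alpha> \<notin> range ofin" shows "ofin n < \<alpha>"
proof (induction n)
  case 0
  then show ?case using assms zero_ordinal_le[of \<alpha>] ofin_0 by (metis order_le_less rangeI)
next
  case (Suc n)
  then show ?case using assms osuc_le ofin_Suc by (metis order_le_less rangeI)
qed

lemma osuc_mem_ofin_iff: "osuc \<alpha> \<in> range ofin \<longleftrightarrow> \<alpha> \<in> range ofin"
proof
  assume "osuc \<alpha> \<in> range ofin"
  then obtain m where m: "osuc \<alpha> = ofin m" by blast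
  then obtain k where "m = Suc k" using ofin_0 osuc_neq_zero by (metis not0_implies_Suc)
  then show "\<alpha> \<in> range ofin" using m by (simp add: ofin_Suc osuc_inject)
qed (auto simp flip: ofin_Suc)

section \<open>Free filtrations\<close>

text \<open>Only spanning is required: the least index with a nontrivial component shows that the pieces
  \<open>S \<alpha>\<close> are independent.\<close>

definition (in group) free_filtration :: "('c ordinal \<Rightarrow> 'a set) \<Rightarrow> bool" where
  "free_filtration V \<longleftrightarrow>
    (\<exists>S. (\<forall>\<alpha>. subgroup (S \<alpha>) G \<and> S \<alpha> \<subseteq> V \<alpha> \<and> S \<alpha> \<inter> V (osuc \<alpha>) \<subseteq> {\<one>}) \<and>
      V 0 \<subseteq> generate G (\<Union>\<alpha>. S \<alpha>))"

lemma (in comm_group) filtration_components_trivial: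
  fixes V S :: "'c ordinal \<Rightarrow> 'a set"
  assumes V: "\<And>\<alpha>. subgroup (V \<alpha>) G" "\<And>\<alpha> \<beta>. \<alpha> \<le> \<beta> \<Longrightarrow> V \<beta> \<subseteq> V \<alpha>"
    and S: "\<And>\<alpha>. S \<alpha> \<subseteq> V \<alpha>" "\<And>\<alpha>. S \<alpha> \<inter> V (osuc \<alpha>) \<subseteq> {\<one>}"
    and f: "finite F" "\<forall>\<alpha>\<in>F. f \<alpha> \<in> S \<alpha>" "finprod G f F \<in> V \<beta>"
    and \<gamma>: "\<gamma> \<in> F" "\<gamma> < \<beta>"
  shows "f \<gamma> = \<one>"
proof (rule ccontr)
  assume "f \<gamma> \<noteq> \<one>"
  let ?A = "{\<alpha> \<in> F. \<alpha> < \<beta> \<and> f \<alpha> \<noteq> \<one>}"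
  define \<alpha> where "\<alpha> = Min ?A"
  have "finite ?A" "?A \<noteq> {}" using f(1) \<gamma> \<open>f \<gamma> \<noteq> \<one>\<close> by auto
  then have "\<alpha> \<in> ?A" and min: "\<And>\<delta>. \<delta> \<in> ?A \<Longrightarrow> \<alpha> \<le> \<delta>"
    unfolding \<alpha>_def using Min_in by (blast, simp)
  then have \<alpha>: "\<alpha> \<in> F" "\<alpha> < \<beta>" "f \<alpha> \<noteq> \<one>" by auto
  have fc: "f \<delta> \<in> carrier G" if "\<delta> \<in> F" for \<delta>
    using f(2) that S(1) subgroup.mem_carrier[OF V(1)] by blast
  have "f \<delta> \<in> V (osuc \<alpha>)" if "\<delta> \<in> F - {\<alpha>}" for \<delta>
  proof (cases "\<delta> < \<alpha>")
    case True
    then have "f \<delta> = \<one>" using that min[of \<delta>] \<alpha> by force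
    then show ?thesis using subgroup.one_closed[OF V(1)] by simp
  next
    case False
    then have "osuc \<alpha> \<le> \<delta>" using that by (intro osuc_le) auto
    then show ?thesis using that f(2) S(1)[of \<delta>] V(2) by blast
  qed
  then have rest: "finprod G f (F - {\<alpha>}) \<in> V (osuc \<alpha>)"
    by (intro subgroup_finprod_closed V(1))
  have "finprod G f F = f \<alpha> \<otimes> finprod G f (F - {\<alpha>})"
    using finprod_insert[of "F - {\<alpha>}" \<alpha> f] f(1) fc \<alpha>(1) by (simp add: insert_absorb)
  also have "\<dots> = finprod G f (F - {\<alpha>}) \<otimes> f \<alpha>"
    using fc \<alpha> by (intro m_comm) auto
  finally have "finprod G f (F - {\<alpha>}) \<otimes> f \<alpha> \<in> V (osuc \<alpha>)"
    using f(3) V(2)[OF osuc_le[OF \<alpha>(2)]] by auto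
  then have "f \<alpha> \<in> V (osuc \<alpha>)"
    using subgroup_inv_mult_mem[OF V(1) rest fc[OF \<alpha>(1)]] by blast
  then show False using S(2)[of \<alpha>] f(2) \<alpha>(1,3) by blast
qed

text \<open>\<open>W\<close> is \<open>V\<close> with the indices in \<open>{u k..<u (Suc k)}\<close> merged into the index \<open>k\<close>, and cut off below
  \<open>u 0\<close>; the infinite indices are unchanged.\<close>

context comm_group begin

context
  fixes V W :: "'c ordinal \<Rightarrow> 'a set" and u :: "nat \<Rightarrow> nat" and p :: nat
  assumes p: "Factorial_Ring.prime p"
    and V: "\<And>\<alpha>. subgroup (V \<alpha>) G" "\<And>\<alpha> \<beta>. \<alpha> \<le> \<beta> \<Longrightarrow> V \<beta> \<subseteq> V \<alpha>"
    and exp: "\<And>x. x \<in> V 0 \<Longrightarrow> x [^] p = \<one>"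
    and u: "mono u" "\<And>k. k \<le> u k"
    and W_fin: "\<And>k. W (ofin k) = V (ofin (u k))"
    and W_inf: "\<And>\<alpha>. \<alpha> \<notin> range ofin \<Longrightarrow> W \<alpha> = V \<alpha>"
begin

private lemma V_ofin_mono: "m \<le> n \<Longrightarrow> V (ofin n) \<subseteq> V (ofin m)"
  using V(2) strict_mono_less_eq[OF strict_mono_ofin] by blast

private lemma ex_block:
  assumes "u 0 \<le> n"
  obtains k where "u k \<le> n" "n < u (Suc k)"
proof -
  define k where "k = (LEAST k. n < u (Suc k))"
  have *: "n < u (Suc k)" unfolding k_def
    by (rule LeastI[of _ n]) (use u(2)[of "Suc n"] in simp)
  have "u k \<le> n"
  proof (cases k)
    case (Suc j)
    then show ?thesis using not_less_Least[of j "\<lambda>k. n < u (Suc k)"] by (simp add: k_def)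
  qed (use assms in simp)
  then show ?thesis using * that by blast
qed

private lemma Least_block:
  assumes "u k \<le> n" "n < u (Suc k)"
  shows "(LEAST k. n < u (Suc k)) = k"
proof (rule Least_equality)
  fix j assume "n < u (Suc j)"
  then show "k \<le> j" using monoD[OF u(1), of "Suc j" k] assms(1) by (metis leD le_trans not_less_eq_eq)
qed fact

lemma free_filtration_coarsen:
  assumes "free_filtration V" shows "free_filtration W"
proof -
  obtain S where S: "\<And>\<alpha>. subgroup (S \<alpha>) G" "\<And>\<alpha>. S \<alpha> \<subseteq> V \<alpha>" "\<And>\<alpha>. S \<alpha> \<inter> V (osuc \<alpha>) \<subseteq> {\<one>}"
    and span: "V 0 \<subseteq> generate G (\<Union>\<alpha>. S \<alpha>)"
    using assms unfolding free_filtration_def by metis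
  have Sc: "S \<alpha> \<subseteq> carrier G" for \<alpha> using S(1) subgroup.subset by blast
  define blk where "blk k = (ofin ` {u k..<u (Suc k)} :: 'c ordinal set)" for k
  define T where "T \<alpha> = (if \<alpha> \<in> range ofin then generate G (\<Union>\<beta>\<in>blk (the_inv ofin \<alpha>). S \<beta>)
    else S \<alpha>)" for \<alpha> :: "'c ordinal"
  have T_fin: "T (ofin k) = generate G (\<Union>\<beta>\<in>blk k. S \<beta>)" for k
    by (simp add: T_def the_inv_ofin)
  have T_inf: "T \<alpha> = S \<alpha>" if "\<alpha> \<notin> range ofin" for \<alpha> using that by (simp add: T_def)
  have T_sub: "subgroup (T \<alpha>) G" for \<alpha>
    unfolding T_def using S(1) Sc by (auto intro: generate_is_subgroup)
  have "T \<alpha> \<subseteq> W \<alpha> \<and> T \<alpha> \<inter> W (osuc \<alpha>) \<subseteq> {\<one>}" for \<alpha>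
  proof (cases "\<alpha> \<in> range ofin")
    case True
    then obtain k where \<alpha>: "\<alpha> = ofin k" by blast
    have "S (ofin n) \<subseteq> V (ofin (u k))" if "u k \<le> n" for n
      using S(2) V_ofin_mono[OF that] by blast
    then have "T \<alpha> \<subseteq> W \<alpha>"
      unfolding \<alpha> T_fin W_fin blk_def by (intro generate_subgroup_incl V(1)) fastforce
    moreover have "x = \<one>" if x: "x \<in> T \<alpha>" "x \<in> W (osuc \<alpha>)" for x
    proof -
      obtain F f where F: "finite F" "F \<subseteq> blk k" "\<forall>\<beta>\<in>F. f \<beta> \<in> S \<beta>" "x = finprod G f F"
        using x(1) unfolding \<alpha> T_fin by (rule generate_UnionE[OF S(1)])
      have xV: "finprod G f F \<in> V (ofin (u (Suc k)))"
        using x(2) F(4) by (simp add: \<alpha> W_fin flip: ofin_Suc)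
      have "f \<beta> = \<one>" if "\<beta> \<in> F" for \<beta>
      proof (rule filtration_components_trivial[OF V S(2,3) F(1,3) xV that])
        show "\<beta> < ofin (u (Suc k))"
          using that F(2) by (auto simp: blk_def strict_mono_less[OF strict_mono_ofin])
      qed
      then show ?thesis using F(4) by (simp add: finprod_one_eqI)
    qed
    ultimately show ?thesis by blast
  next
    case False
    then show ?thesis using S(2,3) by (simp add: T_inf W_inf osuc_mem_ofin_iff)
  qed
  moreover have "W 0 \<subseteq> generate G (\<Union>\<alpha>. T \<alpha>)" (is "_ \<subseteq> ?Z")
  proof
    have Z: "subgroup ?Z G" using T_sub subgroup.subset by (intro generate_is_subgroup) blast
    have TZ: "T \<alpha> \<subseteq> ?Z" for \<alpha> by (auto intro: generate.incl)
    fix x assume "x \<in> W 0"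
    then have x: "x \<in> V (ofin (u 0))" using W_fin[of 0] by (simp add: ofin_0)
    then have "x \<in> V 0" using V_ofin_mono[of 0 "u 0"] by (auto simp: ofin_0)
    then have "x \<in> generate G (\<Union>\<alpha>. S \<alpha>)" using span by blast
    then obtain F f where F: "finite F" "F \<subseteq> UNIV" "\<forall>\<beta>\<in>F. f \<beta> \<in> S \<beta>" "x = finprod G f F"
      by (rule generate_UnionE[OF S(1)])
    have "f \<beta> \<in> ?Z" if \<beta>: "\<beta> \<in> F" for \<beta>
    proof (cases "\<beta> \<in> range ofin")
      case True
      then obtain n where n: "\<beta> = ofin n" by blast
      show ?thesis
      proof (cases "n < u 0")
        case True
        have "f \<beta> = \<one>"
          by (rule filtration_components_trivial[OF V S(2,3) F(1,3) x[unfolded F(4)] \<beta>])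
            (use True n in \<open>simp_all add: strict_mono_less[OF strict_mono_ofin]\<close>)
        then show ?thesis using subgroup.one_closed[OF Z] by simp
      next
        case False
        then obtain k where "u k \<le> n" "n < u (Suc k)" using ex_block[of n] by auto
        then have "f \<beta> \<in> T (ofin k)"
          using F(3) \<beta> n unfolding T_fin blk_def by (auto intro!: generate.incl)
        then show ?thesis using TZ by blast
      qed
    next
      case False
      then show ?thesis using F(3) \<beta> TZ[of \<beta>] by (auto simp: T_inf)
    qed
    then show "x \<in> ?Z" unfolding F(4) by (rule subgroup_finprod_closed[OF Z])
  qed
  ultimately show ?thesis unfolding free_filtration_def using T_sub by blast
qed

lemma free_filtration_refine:
  assumes "free_filtration W" shows "free_filtration V"
proof -
  obtain T where T: "\<And>\<alpha>. subgroup (T \<alpha>) G" "\<And>\<alpha>. T \<alpha> \<subseteq> W \<alpha>" "\<And>\<alpha>. T \<alpha> \<inter> W (osuc \<alpha>) \<subseteq> {\<one>}"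
    and span: "W 0 \<subseteq> generate G (\<Union>\<alpha>. T \<alpha>)"
    using assms unfolding free_filtration_def by metis
  define R where "R n = (if n < u 0 then V 0 else T (ofin (LEAST k. n < u (Suc k))))" for n
  have R: "subgroup (R n) G" for n using V(1) T(1) by (simp add: R_def)
  have "\<exists>C. subgroup C G \<and> C \<subseteq> R n \<inter> V (ofin n) \<and> R n \<inter> V (ofin (Suc n)) \<inter> C \<subseteq> {\<one>} \<and>
      R n \<inter> V (ofin n) \<subseteq> (R n \<inter> V (ofin (Suc n))) <#> C" for n
  proof (rule elementary_complement[OF p, of "R n \<inter> V (ofin (Suc n))" "R n \<inter> V (ofin n)"])
    show "R n \<inter> V (ofin (Suc n)) \<subseteq> R n \<inter> V (ofin n)" using V_ofin_mono[of n "Suc n"] by auto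
    show "x [^] p = \<one>" if "x \<in> R n \<inter> V (ofin n)" for x
      using that exp V(2)[OF zero_ordinal_le] by blast
  qed (use R V(1) in \<open>auto intro: subgroups_Inter_pair\<close>)
  then obtain C where C: "\<And>n. subgroup (C n) G" "\<And>n. C n \<subseteq> R n \<inter> V (ofin n)"
    "\<And>n. R n \<inter> V (ofin (Suc n)) \<inter> C n \<subseteq> {\<one>}"
    "\<And>n. R n \<inter> V (ofin n) \<subseteq> (R n \<inter> V (ofin (Suc n))) <#> C n"
    by metis
  define S where "S \<alpha> = (if \<alpha> \<in> range ofin then C (the_inv ofin \<alpha>) else T \<alpha>)" for \<alpha> :: "'c ordinal"
  have S_fin: "S (ofin n) = C n" for n
    by (simp add: S_def the_inv_ofin)
  have S_inf: "S \<alpha> = T \<alpha>" if "\<alpha> \<notin> range ofin" for \<alpha> using that by (simp add: S_def)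
  have S: "subgroup (S \<alpha>) G" for \<alpha> unfolding S_def using T(1) C(1) by simp
  have "S \<alpha> \<subseteq> V \<alpha> \<and> S \<alpha> \<inter> V (osuc \<alpha>) \<subseteq> {\<one>}" for \<alpha>
  proof (cases "\<alpha> \<in> range ofin")
    case True
    then obtain n where \<alpha>: "\<alpha> = ofin n" by blast
    show ?thesis unfolding \<alpha> S_fin using C(2,3)[of n] by (auto simp: ofin_Suc)
  next
    case False
    then show ?thesis using T(2,3)[of \<alpha>] by (simp add: S_inf W_inf osuc_mem_ofin_iff)
  qed
  moreover have "V 0 \<subseteq> generate G (\<Union>\<alpha>. S \<alpha>)" (is "_ \<subseteq> ?Z")
  proof -
    have Z: "subgroup ?Z G" using S subgroup.subset by (intro generate_is_subgroup) blast
    have SZ: "S \<alpha> \<subseteq> ?Z" for \<alpha> by (auto intro: generate.incl)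
    have descend: "A \<inter> V (ofin m) \<subseteq> ?Z"
      if "m \<le> l" "\<And>n. m \<le> n \<Longrightarrow> n < l \<Longrightarrow> R n = A" "A \<inter> V (ofin l) \<subseteq> ?Z" for A m l
      using that(1)
    proof (induction rule: inc_induct)
      case base
      then show ?case by (rule that(3))
    next
      case (step n)
      have "A \<inter> V (ofin n) \<subseteq> (A \<inter> V (ofin (Suc n))) <#> C n"
        using C(4)[of n] that(2)[of n] step.hyps by simp
      also have "\<dots> \<subseteq> ?Z"
        using step.IH SZ[of "ofin n"] subgroup.m_closed[OF Z]
        by (auto simp: S_fin elim!: set_multE)
      finally show ?case .
    qed
    have "T \<alpha> \<subseteq> ?Z" for \<alpha>
    proof (cases "\<alpha> \<in> range ofin")
      case True
      then obtain k where \<alpha>: "\<alpha> = ofin k" by blast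
      have "T \<alpha> \<inter> V (ofin (u k)) \<subseteq> ?Z"
      proof (rule descend[of "u k" "u (Suc k)"])
        show "u k \<le> u (Suc k)" using u(1) by (simp add: monoD)
        show "R n = T \<alpha>" if "u k \<le> n" "n < u (Suc k)" for n
          using that monoD[OF u(1), of 0 k] by (simp add: R_def \<alpha> Least_block)
        show "T \<alpha> \<inter> V (ofin (u (Suc k))) \<subseteq> ?Z"
          using T(3)[of \<alpha>] subgroup.one_closed[OF Z] by (auto simp: \<alpha> W_fin simp flip: ofin_Suc)
      qed
      then show ?thesis using T(2)[of \<alpha>] by (auto simp: \<alpha> W_fin)
    next
      case False
      then show ?thesis using SZ[of \<alpha>] by (simp add: S_inf)
    qed
    then have "generate G (\<Union>\<alpha>. T \<alpha>) \<subseteq> ?Z" by (intro generate_subgroup_incl Z) auto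
    then have "V 0 \<inter> V (ofin (u 0)) \<subseteq> ?Z" using span W_fin[of 0] by (auto simp: ofin_0)
    then have "V 0 \<inter> V (ofin 0) \<subseteq> ?Z" by (intro descend[of 0 "u 0"]) (auto simp: R_def)
    then show ?thesis by (simp add: ofin_0)
  qed
  ultimately show ?thesis unfolding free_filtration_def using S by blast
qed

end

end

section \<open>Abelian p-groups and heights\<close>

lemma (in comm_group) mult_eq_mult_imp:
  assumes "a \<otimes> x = b \<otimes> y" "a \<in> carrier G" "b \<in> carrier G" "x \<in> carrier G" "y \<in> carrier G"
  shows "a \<otimes> inv b = y \<otimes> inv x"
proof -
  have "a = (y \<otimes> inv x) \<otimes> b"
    using assms by (metis inv_closed inv_solve_right m_assoc m_closed m_comm)
  then show ?thesis using assms by (simp add: m_assoc)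
qed

locale torsion_p_group = comm_group G for G (structure) +
  fixes p :: nat
  assumes prime_p: "Factorial_Ring.prime p"
    and torsion: "x \<in> carrier G \<Longrightarrow> \<exists>n. x [^] (p ^ n) = \<one>"
begin

definition ppw :: "nat \<Rightarrow> 'a set \<Rightarrow> 'a set" where
  "ppw n H = (\<lambda>x. x [^] (p ^ n)) ` H"

text \<open>The elements of infinite height: \<open>p\<^sup>\<omega> G\<close>.\<close>

definition pomega :: "'a set \<Rightarrow> 'a set" where
  "pomega H = (\<Inter>n. ppw n H)"

lemma ppwI: "x \<in> H \<Longrightarrow> x [^] (p ^ n) \<in> ppw n H"
  by (simp add: ppw_def)

lemma ppwE:
  assumes "y \<in> ppw n H" obtains x where "x \<in> H" "y = x [^] (p ^ n)"
  using assms by (auto simp: ppw_def)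

lemma pow_p_pow: "x \<in> carrier G \<Longrightarrow> (x [^] (p ^ m)) [^] (p ^ n) = x [^] (p ^ (m + n))"
  by (simp add: nat_pow_pow power_add)

lemma pow_Suc_p: "x \<in> carrier G \<Longrightarrow> (x [^] (p ^ m)) [^] p = x [^] (p ^ Suc m)"
  using pow_p_pow[of x m 1] by simp

lemma pow_p_Suc: "x \<in> carrier G \<Longrightarrow> (x [^] p) [^] (p ^ m) = x [^] (p ^ Suc m)"
  using pow_p_pow[of x 1 m] by simp

lemma subgroup_ppw:
  assumes H: "subgroup H G" shows "subgroup (ppw n H) G"
proof (rule subgroupI)
  have c: "x \<in> carrier G" if "x \<in> H" for x using that H by (rule subgroup.mem_carrier[rotated])
  show "ppw n H \<subseteq> carrier G" using c by (auto simp: ppw_def)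
  show "ppw n H \<noteq> {}" using subgroup.one_closed[OF H] by (auto simp: ppw_def)
  fix a assume "a \<in> ppw n H"
  then obtain x where x: "x \<in> H" "a = x [^] (p ^ n)" by (rule ppwE)
  then have "inv a = inv x [^] (p ^ n)" using c by (simp add: nat_pow_inv)
  then show "inv a \<in> ppw n H" using x subgroup.m_inv_closed[OF H] by (simp add: ppwI)
  fix b assume "b \<in> ppw n H"
  then obtain y where y: "y \<in> H" "b = y [^] (p ^ n)" by (rule ppwE)
  then have "a \<otimes> b = (x \<otimes> y) [^] (p ^ n)" using x c by (simp add: nat_pow_distrib)
  then show "a \<otimes> b \<in> ppw n H" using x y subgroup.m_closed[OF H] by (simp add: ppwI)
qed

lemma ppw_0: "subgroup H G \<Longrightarrow> ppw 0 H = H"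
  using subgroup.mem_carrier by (force simp: ppw_def)

lemma ppw_ppw: "subgroup H G \<Longrightarrow> ppw m (ppw n H) = ppw (n + m) H"
  unfolding ppw_def image_image by (intro image_cong) (simp_all add: pow_p_pow subgroup.mem_carrier)

lemma ppw_subset: "subgroup H G \<Longrightarrow> ppw n H \<subseteq> H"
  by (auto simp: ppw_def subgroup_nat_pow_closed)

lemma ppw_mono: "H \<subseteq> K \<Longrightarrow> ppw n H \<subseteq> ppw n K"
  by (auto simp: ppw_def)

lemma ppw_antimono:
  assumes "subgroup H G" "m \<le> n" shows "ppw n H \<subseteq> ppw m H"
  using ppw_subset[OF subgroup_ppw[OF assms(1)], of "n - m" m] assms by (simp add: ppw_ppw)

lemma subgroup_pomega: "subgroup H G \<Longrightarrow> subgroup (pomega H) G"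
  unfolding pomega_def by (intro subgroups_Inter) (auto intro: subgroup_ppw)

lemma pomega_subset_ppw: "pomega H \<subseteq> ppw n H"
  by (auto simp: pomega_def)

abbreviation soc :: "'a set" where "soc \<equiv> p_socle p G"

lemma subgroup_soc: "subgroup soc G"
  by (rule subgroupI) (auto simp: p_socle_def nat_pow_distrib nat_pow_inv)

lemma socD: "x \<in> soc \<Longrightarrow> x \<in> carrier G" "x \<in> soc \<Longrightarrow> x [^] p = \<one>"
  by (simp_all add: p_socle_def)

lemma ppw_soc_mem: "c \<in> carrier G \<Longrightarrow> c [^] (p ^ n) \<in> soc \<longleftrightarrow> c [^] (p ^ Suc n) = \<one>"
  by (simp add: p_socle_def pow_Suc_p del: power_Suc)

lemma int_p_pow: "x \<in> carrier G \<Longrightarrow> x [^] (int (p ^ n) * t) = (x [^] (p ^ n)) [^] t"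
  by (simp add: int_pow_pow[symmetric] int_pow_int del: of_nat_power)

lemma int_p_pow_exponent:
  assumes "i \<le> n" shows "t * (int (p ^ i) * int (p ^ (n - i))) = t * int (p ^ n)"
  using assms by (metis le_add_diff_inverse of_nat_mult power_add)

lemma generate_soc_trivial_Int:
  assumes s: "s \<in> soc" "s \<notin> U" and U: "subgroup U G"
  shows "U \<inter> generate G {s} \<subseteq> {\<one>}"
proof
  fix x assume "x \<in> U \<inter> generate G {s}"
  then obtain t :: int where t: "x = s [^] t" "x \<in> U"
    using generate_pow[of s] socD[OF s(1)] by auto
  then have "int p dvd t"
    using s socD[OF s(1)] subgroup.one_closed[OF U]
    by (intro subgroup_prime_pow_dvd[OF U, of s]) (simp_all add: prime_p)
  then obtain r where "t = int p * r" by blast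
  then show "x \<in> {\<one>}" using t int_p_pow[of s 1 r] socD[OF s(1)] by simp
qed

text \<open>If \<open>s = p\<^sup>n c\<close> is in the socle and has height exactly \<open>n\<close>, then \<open>\<langle>c\<rangle>\<close> is a direct summand;
  the complement is a subgroup maximal with respect to containing \<open>p\<^sup>n\<^sup>+\<^sup>1 G\<close> and avoiding \<open>s\<close>.\<close>

lemma cyclic_summand:
  assumes c: "c \<in> carrier G" "c [^] (p ^ n) \<in> soc" "c [^] (p ^ n) \<notin> ppw (Suc n) (carrier G)"
  obtains H where "subgroup H G" "ppw (Suc n) (carrier G) \<subseteq> H"
    "\<And>g. g \<in> carrier G \<Longrightarrow> \<exists>t::int. \<exists>h\<in>H. g = c [^] t \<otimes> h"
    "\<And>t::int. c [^] t \<in> H \<Longrightarrow> int (p ^ Suc n) dvd t"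
proof -
  define s where "s = c [^] (p ^ n)"
  let ?U = "ppw (Suc n) (carrier G)" and ?A = "generate G {s}"
  have U: "subgroup ?U G" by (intro subgroup_ppw subgroup_self)
  have s: "s \<in> soc" "s \<notin> ?U" "s \<in> carrier G" using c by (simp_all add: s_def)
  have A: "subgroup ?A G" using s by (intro generate_is_subgroup) simp
  obtain H where H: "subgroup H G" "?U \<subseteq> H" "H \<inter> ?A \<subseteq> {\<one>}"
    "\<forall>x\<in>carrier G. x [^] p \<in> H \<longrightarrow> x \<in> ?A <#> H"
    using ex_maximal_disjoint_subgroup[OF prime_p U A generate_soc_trivial_Int[OF s(1,2) U]]
    by metis
  have Hc: "h \<in> carrier G" if "h \<in> H" for h using subgroup.mem_carrier[OF H(1) that] .
  have "s \<noteq> \<one>" using s(2) subgroup.one_closed[OF U] by auto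
  then have sH: "s \<notin> H" using H(3) generate.incl[of s "{s}" G] by blast
  have sp: "s [^] p \<in> H" using socD(2)[OF s(1)] subgroup.one_closed[OF H(1)] by simp
  have dec: "\<exists>t::int. \<exists>h\<in>H. g = c [^] t \<otimes> h"
    if "i \<le> Suc n" "g \<in> carrier G" "g [^] (p ^ i) \<in> H" for i g
    using that
  proof (induction i arbitrary: g)
    case 0
    then show ?case by (intro exI[of _ 0] bexI[of _ g]) simp_all
  next
    case (Suc i)
    have "g [^] (p ^ i) \<in> ?A <#> H"
      using H(4) Suc.prems by (simp add: pow_Suc_p del: power_Suc)
    then obtain a h where ah: "a \<in> ?A" "h \<in> H" "g [^] (p ^ i) = a \<otimes> h" by (rule set_multE)
    obtain t :: int where t: "a = s [^] t" using ah(1) generate_pow[OF s(3)] by auto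
    define r where "r = int (p ^ (n - i)) * t"
    define g' where "g' = inv (c [^] r) \<otimes> g"
    have "(c [^] r) [^] (p ^ i) = c [^] (int (p ^ n) * t)"
      using c(1) Suc.prems(1)
      by (simp add: r_def int_pow_pow int_pow_int[symmetric] mult_ac del: of_nat_power)
        (simp only: int_p_pow_exponent Suc_leD Suc_le_mono)
    also have "\<dots> = a" using c(1) unfolding t s_def by (rule int_p_pow)
    finally have "g' [^] (p ^ i) = inv a \<otimes> (a \<otimes> h)"
      using c(1) Suc.prems(2) by (simp add: g'_def nat_pow_distrib nat_pow_inv ah(3))
    also have "\<dots> = h"
      using subgroup.mem_carrier[OF A ah(1)] Hc[OF ah(2)] by (simp add: m_assoc[symmetric])
    finally have "g' [^] (p ^ i) \<in> H" using ah(2) by simp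
    then obtain t' :: int and h' where h': "h' \<in> H" "g' = c [^] t' \<otimes> h'"
      using Suc.IH[of g'] Suc.prems c(1) by (auto simp: g'_def)
    have "g = c [^] r \<otimes> g'" using c(1) Suc.prems(2) by (simp add: g'_def m_assoc[symmetric])
    also have "\<dots> = c [^] (r + t') \<otimes> h'"
      using c(1) h' Hc by (simp add: int_pow_mult m_assoc)
    finally show ?case using h'(1) by blast
  qed
  have dvd: "int (p ^ i) dvd t" if "i \<le> Suc n" "c [^] t \<in> H" for i and t :: int
    using that(1)
  proof (induction i)
    case (Suc i)
    then obtain r where r: "t = int (p ^ i) * r" by (meson Suc_leD dvdE)
    have "(c [^] t) [^] (p ^ (n - i)) = c [^] (int (p ^ n) * r)"
      using c(1) Suc.prems(1)
      by (simp add: r int_pow_pow int_pow_int[symmetric] mult_ac del: of_nat_power)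
        (simp only: int_p_pow_exponent)
    also have "\<dots> = s [^] r" using c(1) unfolding s_def by (rule int_p_pow)
    finally have "s [^] r \<in> H" using subgroup_nat_pow_closed[OF H(1) that(2)] by metis
    then have "int p dvd r" by (rule subgroup_prime_pow_dvd[OF H(1) s(3) sH _ sp prime_p])
    then show ?case by (simp add: r mult_dvd_mono mult.commute)
  qed simp
  show ?thesis
  proof (rule that[OF H(1,2)])
    show "\<exists>t::int. \<exists>h\<in>H. g = c [^] t \<otimes> h" if "g \<in> carrier G" for g
      using dec[of "Suc n" g] that H(2) ppwI[of g "carrier G" "Suc n"] by blast
    show "int (p ^ Suc n) dvd t" if "c [^] t \<in> H" for t :: int
      using dvd[of "Suc n" t] that by blast
  qed
qed

lemma ex_endomorphism:
  assumes c: "c \<in> carrier G" "c [^] (p ^ n) \<in> soc" "c [^] (p ^ n) \<notin> ppw (Suc n) (carrier G)"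
    and w: "w \<in> carrier G" "w [^] (p ^ Suc n) = \<one>"
  obtains f where "f \<in> hom G G" "f c = w" "\<And>g. g \<in> ppw (Suc n) (carrier G) \<Longrightarrow> f g = \<one>"
proof -
  obtain H where H: "subgroup H G" "ppw (Suc n) (carrier G) \<subseteq> H"
    and dec: "\<And>g. g \<in> carrier G \<Longrightarrow> \<exists>t::int. \<exists>h\<in>H. g = c [^] t \<otimes> h"
    and dvd: "\<And>t::int. c [^] t \<in> H \<Longrightarrow> int (p ^ Suc n) dvd t"
    using cyclic_summand[OF c] by blast
  have Hc: "h \<in> carrier G" if "h \<in> H" for h using subgroup.mem_carrier[OF H(1) that] .
  define e where "e g = (SOME t::int. \<exists>h\<in>H. g = c [^] t \<otimes> h)" for g
  define f where "f g = w [^] e g" for g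
  have f: "f (c [^] t \<otimes> h) = w [^] t" if h: "h \<in> H" for t :: int and h
  proof -
    let ?g = "c [^] t \<otimes> h"
    have "\<exists>h'\<in>H. ?g = c [^] e ?g \<otimes> h'"
      unfolding e_def by (rule someI_ex) (use h in blast)
    then obtain h' where h': "h' \<in> H" "?g = c [^] e ?g \<otimes> h'" by blast
    have "c [^] (t - e ?g) = c [^] t \<otimes> inv (c [^] e ?g)"
      using c(1) by (rule int_pow_diff)
    also have "\<dots> = h' \<otimes> inv h"
      using h'(2) c(1) Hc[OF h] Hc[OF h'(1)] by (intro mult_eq_mult_imp) auto
    also have "\<dots> \<in> H" using h h' H(1) by (simp add: subgroup.m_closed subgroup.m_inv_closed)
    finally obtain r where r: "t - e ?g = int (p ^ Suc n) * r" using dvd by blast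
    have "w [^] (t - e ?g) = \<one>" unfolding r using w int_p_pow[of w "Suc n" r] by simp
    then have "w [^] t \<otimes> inv (w [^] e ?g) = \<one>" using int_pow_diff[OF w(1)] by simp
    then show ?thesis unfolding f_def
      using w(1) by (metis int_pow_closed inv_closed inv_equality inv_inv)
  qed
  have "f \<in> hom G G"
  proof (rule homI)
    show "f x \<in> carrier G" if "x \<in> carrier G" for x using w(1) by (simp add: f_def)
    fix x y assume "x \<in> carrier G" "y \<in> carrier G"
    then obtain t h t' h' where th: "h \<in> H" "x = c [^] (t::int) \<otimes> h" "h' \<in> H" "y = c [^] (t'::int) \<otimes> h'"
      using dec by metis
    have "x \<otimes> y = c [^] (t + t') \<otimes> (h \<otimes> h')"
      using th Hc c(1) by (simp add: int_pow_mult m_ac)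
    then have "f (x \<otimes> y) = w [^] (t + t')"
      using f th subgroup.m_closed[OF H(1)] by simp
    then show "f (x \<otimes> y) = f x \<otimes> f y" using th f w(1) by (simp add: int_pow_mult)
  qed
  moreover have "f c = w"
    using f[OF subgroup.one_closed[OF H(1)], of 1] c(1) w(1) by simp
  moreover have "f g = \<one>" if "g \<in> ppw (Suc n) (carrier G)" for g
    using f[of g 0] that H(2) Hc by (auto simp: subset_iff)
  ultimately show ?thesis using that by blast
qed

section \<open>Fully invariant subgroups\<close>

lemma hom_nat_pow_G:
  assumes "f \<in> hom G G" "x \<in> carrier G" shows "f (x [^] (n::nat)) = f x [^] n"
proof -
  interpret f: group_hom G G f using assms(1) by unfold_locales
  show ?thesis using assms(2) by (rule f.hom_nat_pow)
qed

lemma fully_invariant_ppw: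
  assumes "fully_invariant G M" "subgroup M G" shows "fully_invariant G (ppw n M)"
  unfolding fully_invariant_def
proof (intro ballI image_subsetI)
  fix f y assume f: "f \<in> hom G G" and "y \<in> ppw n M"
  then obtain x where x: "x \<in> M" "y = x [^] (p ^ n)" by (auto elim: ppwE)
  then have "f y = f x [^] (p ^ n)"
    using hom_nat_pow_G[OF f] subgroup.mem_carrier[OF assms(2)] by simp
  moreover have "f x \<in> M" using assms(1) f x(1) unfolding fully_invariant_def by blast
  ultimately show "f y \<in> ppw n M" by (simp add: ppwI)
qed

lemma fully_invariant_carrier: "fully_invariant G (carrier G)"
  by (auto simp: fully_invariant_def hom_def)

lemma fully_invariant_Int:
  "fully_invariant G M \<Longrightarrow> fully_invariant G N \<Longrightarrow> fully_invariant G (M \<inter> N)"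
  unfolding fully_invariant_def by blast

lemma fully_invariant_soc_mem:
  assumes M: "fully_invariant G M" and s: "s \<in> M" "s \<in> soc" "s \<in> ppw n (carrier G)"
    "s \<notin> ppw (Suc n) (carrier G)" and y: "y \<in> soc" "y \<in> ppw n (carrier G)"
  shows "y \<in> M"
proof -
  obtain c where c: "c \<in> carrier G" "s = c [^] (p ^ n)" using s(3) by (rule ppwE)
  obtain w where w: "w \<in> carrier G" "y = w [^] (p ^ n)" using y(2) by (rule ppwE)
  have "w [^] (p ^ Suc n) = \<one>" using ppw_soc_mem[of w n] w y(1) by simp
  then obtain f where f: "f \<in> hom G G" "f c = w"
    using ex_endomorphism[of c n w] c s w by metis
  then have "f s = y" using c w by (simp add: hom_nat_pow_G)
  then show ?thesis using M f(1) s(1) unfolding fully_invariant_def by blast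
qed

lemma ex_height:
  assumes "x \<in> carrier G" "x \<notin> ppw m (carrier G)"
  obtains n where "n < m" "x \<in> ppw n (carrier G)" "x \<notin> ppw (Suc n) (carrier G)"
proof -
  define k where "k = (LEAST k. x \<notin> ppw k (carrier G))"
  have k: "x \<notin> ppw k (carrier G)" "k \<le> m"
    unfolding k_def using assms(2) by (rule LeastI, rule Least_le)
  have "k \<noteq> 0" using k assms(1) by (metis ppw_0 subgroup_self)
  then obtain n where "k = Suc n" by (metis not0_implies_Suc)
  moreover have "x \<in> ppw n (carrier G)"
    using not_less_Least[of n "\<lambda>k. x \<notin> ppw k (carrier G)"] \<open>k = Suc n\<close> by (simp add: k_def)
  ultimately show ?thesis using k by (intro that[of n]) simp_all
qed

lemma fully_invariant_soc_cases:
  assumes M: "fully_invariant G M"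
  shows "M \<inter> soc \<subseteq> pomega (carrier G) \<or> (\<exists>u. M \<inter> soc = ppw u (carrier G) \<inter> soc)"
proof (rule disjCI)
  assume "\<not> (\<exists>u. M \<inter> soc = ppw u (carrier G) \<inter> soc)"
  show "M \<inter> soc \<subseteq> pomega (carrier G)"
  proof (rule ccontr)
    assume not: "\<not> M \<inter> soc \<subseteq> pomega (carrier G)"
    let ?P = "\<lambda>n. \<exists>x\<in>M \<inter> soc. x \<in> ppw n (carrier G) \<and> x \<notin> ppw (Suc n) (carrier G)"
    define u where "u = (LEAST n. ?P n)"
    have "\<exists>n. ?P n" using not socD(1) ex_height unfolding pomega_def by (smt (verit, del_insts) INT_I IntE subsetI)
    then have "?P u" unfolding u_def by (rule LeastI_ex)
    then obtain s where s: "s \<in> M" "s \<in> soc" "s \<in> ppw u (carrier G)" "s \<notin> ppw (Suc u) (carrier G)"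
      by blast
    have "x \<in> ppw u (carrier G)" if x: "x \<in> M \<inter> soc" for x
    proof (rule ccontr)
      assume "x \<notin> ppw u (carrier G)"
      then obtain n where "n < u" "?P n" using ex_height[of x u] x socD(1) by blast
      then show False using not_less_Least[of n ?P] by (simp add: u_def)
    qed
    then have "M \<inter> soc = ppw u (carrier G) \<inter> soc"
      using fully_invariant_soc_mem[OF M s] by blast
    then show False using \<open>\<not> (\<exists>u. _ u)\<close> by blast
  qed
qed

lemma fully_invariant_subset_pomega:
  assumes M: "fully_invariant G M" "subgroup M G" and soc: "M \<inter> soc \<subseteq> pomega (carrier G)"
  shows "M \<subseteq> pomega (carrier G)"
proof (rule ccontr)
  let ?W = "pomega (carrier G)" and ?P = "\<lambda>n. ppw n (carrier G)"
  have W: "subgroup ?W G" and P: "\<And>n. subgroup (?P n) G"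
    by (intro subgroup_pomega subgroup_ppw subgroup_self)+
  assume "\<not> M \<subseteq> ?W"
  then obtain x where x: "x \<in> M" "x \<notin> ?W" by blast
  then have xc: "x \<in> carrier G" using subgroup.mem_carrier[OF M(2)] by blast
  then obtain m where "x [^] (p ^ m) = \<one>" using torsion by blast
  then have ex: "\<exists>i. x [^] (p ^ i) \<in> ?W" using subgroup.one_closed[OF W] by metis
  define i where "i = (LEAST i. x [^] (p ^ i) \<in> ?W)"
  have i: "x [^] (p ^ i) \<in> ?W" unfolding i_def by (rule LeastI_ex[OF ex])
  have "i \<noteq> 0" using i x xc by (metis nat_pow_eone power_0)
  then obtain j where j: "i = Suc j" by (metis not0_implies_Suc)
  define y where "y = x [^] (p ^ j)"
  have y: "y \<in> M" "y \<in> carrier G" "y [^] p \<in> ?W"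
    using x xc i subgroup_nat_pow_closed[OF M(2)] by (simp_all add: y_def j pow_Suc_p del: power_Suc)
  have "y \<notin> ?W"
    using not_less_Least[of j "\<lambda>i. x [^] (p ^ i) \<in> ?W"] j by (simp add: i_def y_def)
  then obtain m where "y \<notin> ?P m" by (auto simp: pomega_def)
  then obtain n where n: "y \<in> ?P n" "y \<notin> ?P (Suc n)" using ex_height[OF y(2)] by blast
  obtain z where z: "z \<in> carrier G" "y [^] p = z [^] (p ^ Suc (Suc n))"
    using y(3) pomega_subset_ppw by (blast elim: ppwE)
  define v where "v = z [^] (p ^ Suc n)"
  have v: "v \<in> carrier G" "v \<in> ?P (Suc n)" "v [^] p = y [^] p"
    using z by (simp_all add: v_def pow_Suc_p ppwI del: power_Suc)
  have vn: "v \<in> ?P n" using v(2) ppw_antimono[OF subgroup_self, of n "Suc n"] by auto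
  define s where "s = inv v \<otimes> y"
  have ys: "y = v \<otimes> s" using v y by (simp add: s_def m_assoc[symmetric])
  have s: "s \<in> soc" using v y by (simp add: s_def p_socle_def nat_pow_distrib nat_pow_inv)
  have sn: "s \<in> ?P n" unfolding s_def
    using n(1) vn by (intro subgroup.m_closed[OF P] subgroup.m_inv_closed[OF P])
  have sn': "s \<notin> ?P (Suc n)" using n(2) ys v(2) subgroup.m_closed[OF P] by metis
  obtain c where c: "c \<in> carrier G" "s = c [^] (p ^ n)" using sn by (rule ppwE)
  obtain f where f: "f \<in> hom G G" "f c = c" "\<And>g. g \<in> ?P (Suc n) \<Longrightarrow> f g = \<one>"
    using ex_endomorphism[of c n c] c s sn' ppw_soc_mem[of c n] by metis
  have sc: "s \<in> carrier G" using socD(1)[OF s] .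
  have "f y = f v \<otimes> f s" unfolding ys using f(1) v(1) sc by (rule hom_mult)
  also have "\<dots> = s" using f(2) f(3)[OF v(2)] sc hom_nat_pow_G[OF f(1) c(1)] c(2) by simp
  finally have "s \<in> M" using M(1) f(1) y(1) unfolding fully_invariant_def by force
  then show False using soc s sn' by (auto simp: pomega_def)
qed

lemma fully_invariant_contains_torsion:
  assumes "fully_invariant G M" "subgroup M G" "\<And>k. \<not> ppw k M \<inter> soc \<subseteq> pomega (carrier G)"
  shows "\<exists>N. \<forall>y\<in>ppw N (carrier G). y [^] (p ^ m) = \<one> \<longrightarrow> y \<in> M"
  using assms
proof (induction m arbitrary: M)
  case 0
  have "y \<in> M" if "y \<in> ppw 0 (carrier G)" "y [^] (p ^ 0) = \<one>" for y
    using that subgroup.one_closed[OF 0(2)] by (simp add: ppw_0[OF subgroup_self])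
  then show ?case by blast
next
  case (Suc m)
  note M = Suc.prems
  obtain N where N: "\<And>y. y \<in> ppw N (carrier G) \<Longrightarrow> y [^] (p ^ m) = \<one> \<Longrightarrow> y \<in> M"
    using Suc.IH[OF M] by blast
  have P: "subgroup (ppw n (carrier G)) G" for n by (intro subgroup_ppw subgroup_self)
  define M' where "M' = M \<inter> ppw N (carrier G)"
  have M': "fully_invariant G M'" "subgroup M' G"
    unfolding M'_def using M P
    by (auto intro: fully_invariant_Int fully_invariant_ppw fully_invariant_carrier
        subgroup_self subgroups_Inter_pair)
  have "ppw N M \<subseteq> M'"
    unfolding M'_def using ppw_subset[OF M(2)] ppw_mono[OF subgroup.subset[OF M(2)]] by blast
  then have "ppw (N + m) M \<subseteq> ppw m M'"
    using ppw_mono[of "ppw N M" M' m] ppw_ppw[OF M(2)] by simp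
  then have "\<not> ppw m M' \<inter> soc \<subseteq> pomega (carrier G)" using M(3)[of "N + m"] by blast
  then obtain u where u: "ppw m M' \<inter> soc = ppw u (carrier G) \<inter> soc"
    using fully_invariant_soc_cases[OF fully_invariant_ppw[OF M'], of m] by blast
  have "y \<in> M" if y: "y \<in> ppw (max N u) (carrier G)" "y [^] (p ^ Suc m) = \<one>" for y
  proof -
    have yN: "y \<in> ppw N (carrier G)" and yu: "y \<in> ppw u (carrier G)"
      using y(1) ppw_antimono[OF subgroup_self, of N "max N u"]
        ppw_antimono[OF subgroup_self, of u "max N u"] by auto
    then have yc: "y \<in> carrier G" using subgroup.mem_carrier[OF P] by blast
    have "y [^] (p ^ m) \<in> ppw u (carrier G) \<inter> soc"
      using yc y(2) ppw_soc_mem[of y m] subgroup_nat_pow_closed[OF P yu] by simp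
    then obtain l where l: "l \<in> M'" "y [^] (p ^ m) = l [^] (p ^ m)"
      unfolding u[symmetric] by (auto elim: ppwE)
    have lc: "l \<in> carrier G" using subgroup.mem_carrier[OF M'(2) l(1)] .
    have "inv l \<otimes> y \<in> ppw N (carrier G)"
      using l(1) yN unfolding M'_def by (auto intro: subgroup.m_closed[OF P] subgroup.m_inv_closed[OF P])
    moreover have "(inv l \<otimes> y) [^] (p ^ m) = \<one>"
      using lc yc l(2) by (simp add: nat_pow_distrib nat_pow_inv)
    ultimately have "inv l \<otimes> y \<in> M" by (rule N)
    moreover have "l \<in> M" using l(1) by (simp add: M'_def)
    ultimately have "l \<otimes> (inv l \<otimes> y) \<in> M" using subgroup.m_closed[OF M(2)] by blast
    then show "y \<in> M" using lc yc by (simp add: m_assoc[symmetric])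
  qed
  then show ?case by blast
qed

section \<open>Purity and divisible quotients\<close>

lemma pow_coprime_surj:
  assumes H: "subgroup H G" and x: "x \<in> H" and m: "\<not> p dvd m"
  obtains y where "y \<in> H" "y [^] (m::nat) = x"
proof -
  have xc: "x \<in> carrier G" using subgroup.mem_carrier[OF H x] .
  obtain k where k: "x [^] (p ^ k) = \<one>" using torsion[OF xc] by blast
  have "coprime m (p ^ k)"
    using m prime_p by (metis coprime_commute coprime_power_left_iff prime_imp_coprime)
  moreover have "m \<noteq> 0" using m by (metis dvd_0_right)
  ultimately obtain a b where ab: "m * a = p ^ k * b + 1"
    using bezout_nat[of m "p ^ k"] by auto
  have "(x [^] a) [^] m = x [^] (m * a)" using xc by (simp add: nat_pow_pow mult.commute)
  also have "\<dots> = (x [^] (p ^ k)) [^] b \<otimes> x"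
    unfolding ab using xc by (simp add: nat_pow_mult[symmetric] nat_pow_pow)
  also have "\<dots> = x" using k xc by simp
  finally show ?thesis using that subgroup_nat_pow_closed[OF H x] by blast
qed

lemma p_decompose:
  assumes "(n::nat) > 0" obtains e m where "n = p ^ e * m" "\<not> p dvd m"
  using multiplicity_decompose'[of n p] assms prime_p by (metis not_gr0 not_prime_unit)

lemma pure_subgroupI:
  assumes B: "subgroup B G" and pure: "\<And>n. ppw n (carrier G) \<inter> B \<subseteq> ppw n B"
  shows "pure_subgroup G B"
  unfolding pure_subgroup_def
proof (intro conjI B allI equalityI subsetI)
  fix n :: nat and y
  note Bc = subgroup.mem_carrier[OF B]
  { assume "y \<in> (\<lambda>x. x [^] n) ` B"
    then show "y \<in> (\<lambda>x. x [^] n) ` carrier G \<inter> B"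
      using Bc subgroup_nat_pow_closed[OF B] by auto }
  assume "y \<in> (\<lambda>x. x [^] n) ` carrier G \<inter> B"
  then obtain x where x: "x \<in> carrier G" "y = x [^] n" "y \<in> B" by blast
  show "y \<in> (\<lambda>x. x [^] n) ` B"
  proof (cases "n = 0")
    case True
    then show ?thesis using x subgroup.one_closed[OF B] by auto
  next
    case False
    then obtain e m where n: "n = p ^ e * m" "\<not> p dvd m" using p_decompose by blast
    have "y = (x [^] m) [^] (p ^ e)" using x n by (simp add: nat_pow_pow mult.commute)
    then have "y \<in> ppw e B" using pure[of e] x ppwI[of "x [^] m" "carrier G" e] by auto
    then obtain b where b: "b \<in> B" "y = b [^] (p ^ e)" by (rule ppwE)
    obtain b' where b': "b' \<in> B" "b' [^] m = b" using pow_coprime_surj[OF B b(1) n(2)] by blast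
    have "b' [^] n = y"
      using b' b(2) n Bc by (metis mult.commute nat_pow_pow)
    then show ?thesis using b'(1) by blast
  qed
qed

lemma ppw_mult_cover:
  assumes K: "subgroup K G" and B: "subgroup B G" and cover: "K \<subseteq> ppw 1 K <#> B"
  shows "K \<subseteq> ppw n K <#> B"
proof (induction n)
  case 0
  then show ?case using set_mult_subset_left[OF K B] by (simp add: ppw_0[OF K])
next
  case (Suc n)
  show ?case
  proof
    fix x assume "x \<in> K"
    then obtain v b where v: "v \<in> ppw n K" "b \<in> B" "x = v \<otimes> b"
      using Suc by (blast elim: set_multE)
    obtain z where z: "z \<in> K" "v = z [^] (p ^ n)" using v(1) by (rule ppwE)
    obtain w b' where w: "w \<in> ppw 1 K" "b' \<in> B" "z = w \<otimes> b'"
      using cover z(1) by (blast elim: set_multE)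
    have c: "w \<in> carrier G" "b' \<in> carrier G" "b \<in> carrier G"
      using w v subgroup.mem_carrier[OF subgroup_ppw[OF K]] subgroup.mem_carrier[OF B] by blast+
    have "x = w [^] (p ^ n) \<otimes> (b' [^] (p ^ n) \<otimes> b)"
      using v(3) z(2) w(3) c by (simp add: nat_pow_distrib m_assoc)
    moreover have "w [^] (p ^ n) \<in> ppw (Suc n) K"
      using ppwI[OF w(1), of n] ppw_ppw[OF K, of n 1] by simp
    moreover have "b' [^] (p ^ n) \<otimes> b \<in> B"
      using w(2) v(2) subgroup.m_closed[OF B] subgroup_nat_pow_closed[OF B] by blast
    ultimately show "x \<in> ppw (Suc n) K <#> B" by (simp add: set_multI)
  qed
qed

lemma divisible_quotientI:
  assumes B: "subgroup B G" and cover: "carrier G \<subseteq> ppw 1 (carrier G) <#> B"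
  shows "divisible_group (G Mod B)"
  unfolding divisible_group_def
proof (intro allI impI ballI)
  fix n :: nat and q assume n: "n > 0" and q: "q \<in> carrier (G Mod B)"
  interpret B: normal B G using B by (rule subgroup_imp_normal)
  interpret q: group_hom G "G Mod B" "\<lambda>a. B #> a"
    using B.r_coset_hom_Mod B.factorgroup_is_group by (simp add: group_hom_def group_hom_axioms_def is_group)
  obtain x where x: "x \<in> carrier G" "q = B #> x"
    using q by (auto simp: FactGroup_def RCOSETS_def)
  obtain e m where em: "n = p ^ e * m" "\<not> p dvd m" using p_decompose[OF n] by blast
  obtain x' where x': "x' \<in> carrier G" "x' [^] m = x"
    using pow_coprime_surj[OF subgroup_self x(1) em(2)] by blast
  obtain v b where v: "v \<in> ppw e (carrier G)" "b \<in> B" "x' = v \<otimes> b"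
    using ppw_mult_cover[OF subgroup_self B cover, of e] x'(1) by (blast elim: set_multE)
  obtain z where z: "z \<in> carrier G" "v = z [^] (p ^ e)" using v(1) by (rule ppwE)
  have bc: "b \<in> carrier G" using subgroup.mem_carrier[OF B v(2)] .
  have "z [^] n = v [^] m" using z em(1) by (simp add: nat_pow_pow)
  moreover have vc: "v \<in> carrier G" using z by simp
  ultimately have "x = z [^] n \<otimes> b [^] m"
    using x'(2) v(3) bc by (simp add: nat_pow_distrib)
  then have "q = (B #> z [^] n) \<otimes>\<^bsub>G Mod B\<^esub> (B #> b [^] m)"
    using x(2) z(1) bc by (simp del: mult_FactGroup)
  moreover have "B #> b [^] m = B"
    using subgroup_nat_pow_closed[OF B v(2)] bc by (intro coset_join2[OF _ B]) auto
  ultimately have "q = (B #> z [^] n) \<otimes>\<^bsub>G Mod B\<^esub> \<one>\<^bsub>G Mod B\<^esub>" by simp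
  also have "\<dots> = B #> z [^] n" using z(1) q.H.r_one q.hom_closed by (metis nat_pow_closed)
  finally have "(B #> z) [^]\<^bsub>G Mod B\<^esub> n = q" using q.hom_nat_pow[OF z(1)] by simp
  then show "\<exists>y\<in>carrier (G Mod B). y [^]\<^bsub>G Mod B\<^esub> n = q" using q.hom_closed[OF z(1)] by blast
qed

lemma divisible_of_socle:
  assumes K: "subgroup K G" and B: "subgroup B G" "B \<subseteq> K"
    and soc: "\<And>y n. y \<in> K \<Longrightarrow> y [^] p \<in> B \<Longrightarrow> y \<in> ppw n K <#> B"
  shows "K \<subseteq> ppw 1 K <#> B"
proof -
  let ?Q = "ppw 1 K <#> B"
  have Q: "subgroup ?Q G" by (intro mult_subgroups subgroup_ppw K B(1))
  have Kc: "x \<in> carrier G" if "x \<in> K" for x using subgroup.mem_carrier[OF K that] .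
  have "x \<in> ?Q" if "x \<in> K" "x [^] (p ^ m) \<in> B" for m x
    using that
  proof (induction m arbitrary: x)
    case 0
    then show ?case using set_mult_subset_right[OF subgroup_ppw[OF K] B(1)] Kc by auto
  next
    case (Suc m)
    note xc = Kc[OF Suc.prems(1)]
    have "x [^] (p ^ m) \<in> ppw (Suc m) K <#> B"
      using Suc.prems xc by (intro soc) (simp_all add: pow_Suc_p subgroup_nat_pow_closed[OF K] del: power_Suc)
    then obtain v b where v: "v \<in> ppw (Suc m) K" "b \<in> B" "x [^] (p ^ m) = v \<otimes> b" by (rule set_multE)
    obtain z where z: "z \<in> K" "v = z [^] (p ^ Suc m)" using v(1) by (rule ppwE)
    note zc = Kc[OF z(1)]
    have bc: "b \<in> carrier G" using v(2) B(2) Kc by blast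
    define x' where "x' = inv (z [^] p) \<otimes> x"
    have "x' [^] (p ^ m) = inv v \<otimes> (v \<otimes> b)"
      using xc zc by (simp add: x'_def nat_pow_distrib nat_pow_inv pow_p_Suc z(2) v(3) del: power_Suc)
    also have "\<dots> = b" using zc bc z(2) by (simp add: m_assoc[symmetric])
    finally have "x' [^] (p ^ m) \<in> B" using v(2) by simp
    moreover have "x' \<in> K" unfolding x'_def
      using Suc.prems(1) z(1) K by (simp add: subgroup.m_closed subgroup.m_inv_closed subgroup_nat_pow_closed)
    ultimately have x': "x' \<in> ?Q" by (rule Suc.IH[rotated])
    have "z [^] p \<in> ppw 1 K" using ppwI[OF z(1), of 1] by simp
    then have "z [^] p \<in> ?Q" using set_mult_subset_left[OF subgroup_ppw[OF K] B(1)] by blast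
    then have "z [^] p \<otimes> x' \<in> ?Q" using x' subgroup.m_closed[OF Q] by blast
    then show ?case using xc zc by (simp add: x'_def m_assoc[symmetric])
  qed
  moreover have "\<exists>m. x [^] (p ^ m) \<in> B" if "x \<in> K" for x
    using torsion[OF Kc[OF that]] subgroup.one_closed[OF B(1)] by metis
  ultimately show ?thesis by blast
qed

section \<open>Existence of basic subgroups\<close>

text \<open>A family of cyclic subgroups is pure-independent if it generates its direct sum and this sum
  is pure. Both properties are captured by one condition of finite character.\<close>

definition pure_independent :: "'a set set \<Rightarrow> bool" where
  "pure_independent \<C> \<longleftrightarrow>
    (\<forall>F f n. finite F \<longrightarrow> F \<subseteq> \<C> \<longrightarrow> (\<forall>C\<in>F. f C \<in> C) \<longrightarrow>
       finprod G f F \<in> ppw n (carrier G) \<longrightarrow> (\<forall>C\<in>F. f C \<in> ppw n C))"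

lemma pure_independentD:
  assumes "pure_independent \<C>" "finite F" "F \<subseteq> \<C>" "\<forall>C\<in>F. f C \<in> C"
    "finprod G f F \<in> ppw n (carrier G)" "C \<in> F"
  shows "f C \<in> ppw n C"
  using assms unfolding pure_independent_def by metis

lemma pure_independent_pure:
  assumes ind: "pure_independent \<C>" and sub: "\<And>C. C \<in> \<C> \<Longrightarrow> subgroup C G"
  shows "ppw n (carrier G) \<inter> generate G (\<Union>C\<in>\<C>. C) \<subseteq> ppw n (generate G (\<Union>C\<in>\<C>. C))"
proof
  let ?B = "generate G (\<Union>C\<in>\<C>. C)"
  fix y assume y: "y \<in> ppw n (carrier G) \<inter> ?B"
  then have "y \<in> ?B" by blast
  then obtain F f where F: "finite F" "F \<subseteq> \<C>" "\<forall>C\<in>F. f C \<in> C" "y = finprod G f F"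
    by (rule generate_UnionE[of \<C> "\<lambda>C. C", rotated]) (assumption | rule sub)+
  have "\<forall>C\<in>F. \<exists>g. g \<in> C \<and> f C = g [^] (p ^ n)"
    using pure_independentD[OF ind F(1-3)] y F(4) by (blast elim: ppwE)
  then obtain g where g: "\<And>C. C \<in> F \<Longrightarrow> g C \<in> C" "\<And>C. C \<in> F \<Longrightarrow> f C = g C [^] (p ^ n)"
    by metis
  have gc: "g \<in> F \<rightarrow> carrier G"
  proof
    fix C assume "C \<in> F"
    then show "g C \<in> carrier G"
      using g(1) F(2) by (intro subgroup.mem_carrier[OF sub, of C]) auto
  qed
  have "y = finprod G (\<lambda>C. g C [^] (p ^ n)) F"
    unfolding F(4) using gc g(2) by (intro finprod_cong') auto
  also have "\<dots> = finprod G g F [^] (p ^ n)"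
    using F(1) gc
  proof (induction F rule: finite_induct)
    case (insert C F)
    then have "g \<in> F \<rightarrow> carrier G" "g C \<in> carrier G" by auto
    then show ?case using insert by (simp add: nat_pow_distrib Pi_def)
  qed simp
  finally have y: "y = finprod G g F [^] (p ^ n)" .
  have Bs: "subgroup ?B G" using sub subgroup.subset by (intro generate_is_subgroup) blast
  have "finprod G g F \<in> ?B"
    using g(1) F(2) by (intro subgroup_finprod_closed[OF Bs] generate.incl) auto
  then show "y \<in> ppw n ?B" unfolding y by (rule ppwI)
qed

lemma pure_independent_independent:
  assumes ind: "pure_independent \<C>" and cyc: "\<And>C. C \<in> \<C> \<Longrightarrow> \<exists>c\<in>carrier G. C = generate G {c}"
    and F: "finite F" "F \<subseteq> \<C>" "\<forall>C\<in>F. f C \<in> C" "finprod G f F = \<one>" "C \<in> F"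
  shows "f C = \<one>"
proof -
  obtain c where c: "c \<in> carrier G" "C = generate G {c}" using cyc F by blast
  obtain e where e: "c [^] (p ^ e) = \<one>" using torsion[OF c(1)] by blast
  have "f C \<in> ppw e C"
    using subgroup.one_closed[OF subgroup_ppw[OF subgroup_self]] F
    by (intro pure_independentD[OF ind F(1-3) _ F(5)]) simp
  then obtain t :: int where "f C = (c [^] t) [^] (p ^ e)"
    using c generate_pow[OF c(1)] by (auto elim!: ppwE)
  also have "\<dots> = (c [^] (p ^ e)) [^] t"
    using c(1) by (simp add: int_pow_pow int_pow_int[symmetric] mult.commute del: of_nat_power)
  finally show ?thesis using e by simp
qed

lemma cyclic_pure_mod:
  assumes K: "subgroup K G" and B: "subgroup B G"
    and c: "c \<in> K" "c [^] (p ^ Suc n) = \<one>" "c [^] (p ^ n) \<notin> ppw (Suc n) K <#> B"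
    and t: "c [^] (t::int) \<in> ppw m K <#> B"
  shows "c [^] t \<in> ppw m (generate G {c})"
proof -
  have cc: "c \<in> carrier G" using subgroup.mem_carrier[OF K c(1)] .
  have *: "c [^] t = \<one> \<or> int (p ^ m) dvd t"
  proof (rule disjCI)
    let ?Q = "ppw (Suc n) K <#> B"
    have Q: "subgroup ?Q G" by (intro mult_subgroups subgroup_ppw K B)
    assume nd: "\<not> int (p ^ m) dvd t"
    define i where "i = multiplicity (int p) t"
    have "t \<noteq> 0" using nd by auto
    moreover have "\<not> is_unit (int p)" using prime_p by (metis int_dvd_int_iff not_prime_unit of_nat_1)
    ultimately obtain r where r: "t = int p ^ i * r" "\<not> int p dvd r"
      unfolding i_def using multiplicity_decompose' by metis
    have "i < m" using nd r(1) by (metis dvd_triv_left le_imp_power_dvd dvd_trans not_le of_nat_power)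
    show "c [^] t = \<one>"
    proof (rule ccontr)
      assume ct: "c [^] t \<noteq> \<one>"
      have "i \<le> n"
      proof (rule ccontr)
        assume "\<not> i \<le> n"
        then have "int (p ^ Suc n) dvd t" using r(1) by (metis dvd_mult2 le_imp_power_dvd not_less_eq_eq of_nat_power)
        then obtain q where "t = int (p ^ Suc n) * q" by blast
        then show False using ct int_p_pow[OF cc, of "Suc n" q] c(2) by simp
      qed
      let ?e = "p ^ (n - i)"
      obtain v b where v: "v \<in> ppw m K" "b \<in> B" "c [^] t = v \<otimes> b" using t by (rule set_multE)
      have vc: "v \<in> carrier G" "b \<in> carrier G"
        using v subgroup.mem_carrier[OF subgroup_ppw[OF K]] subgroup.mem_carrier[OF B] by blast+
      have "v [^] ?e \<in> ppw (m + (n - i)) K"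
        using ppwI[OF v(1), of "n - i"] ppw_ppw[OF K] by simp
      moreover have "Suc n \<le> m + (n - i)" using \<open>i < m\<close> \<open>i \<le> n\<close> by linarith
      ultimately have "v [^] ?e \<in> ppw (Suc n) K" using ppw_antimono[OF K] by blast
      then have "v [^] ?e \<otimes> b [^] ?e \<in> ?Q"
        using subgroup_nat_pow_closed[OF B v(2)] by (intro set_multI)
      then have "(c [^] t) [^] ?e \<in> ?Q" using v(3) vc by (simp add: nat_pow_distrib)
      moreover have "(c [^] t) [^] ?e = (c [^] (p ^ n)) [^] r"
      proof -
        have "(c [^] t) [^] ?e = c [^] (r * (int (p ^ i) * int ?e))"
          using cc r(1) by (simp add: int_pow_pow int_pow_int[symmetric] mult_ac)
        also have "\<dots> = c [^] (int (p ^ n) * r)"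
          using int_p_pow_exponent[OF \<open>i \<le> n\<close>, of r] by (metis mult.commute)
        finally show ?thesis using int_p_pow[OF cc] by simp
      qed
      ultimately have "(c [^] (p ^ n)) [^] r \<in> ?Q" by simp
      moreover have "(c [^] (p ^ n)) [^] p \<in> ?Q"
        using c(2) cc subgroup.one_closed[OF Q] by (simp add: pow_Suc_p del: power_Suc)
      ultimately have "int p dvd r"
        using cc c(3) by (intro subgroup_prime_pow_dvd[OF Q _ c(3) _ _ prime_p]) simp
      then show False using r(2) by blast
    qed
  qed
  have C: "subgroup (generate G {c}) G" using cc by (intro generate_is_subgroup) simp
  from * show ?thesis
  proof
    assume "c [^] t = \<one>"
    then show ?thesis using subgroup.one_closed[OF subgroup_ppw[OF C]] by simp
  next
    assume "int (p ^ m) dvd t"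
    then obtain q where "t = int (p ^ m) * q" by blast
    then have "c [^] t = (c [^] q) [^] (p ^ m)"
      using cc by (simp add: int_pow_pow int_pow_int[symmetric] mult.commute)
    moreover have "c [^] q \<in> generate G {c}" using generate_pow[OF cc] by blast
    ultimately show ?thesis by (simp add: ppwI)
  qed
qed

lemma pure_independent_insert:
  assumes K: "subgroup K G" "\<And>n. ppw n (carrier G) \<inter> K \<subseteq> ppw n K"
    and ind: "pure_independent \<C>" and sub: "\<And>C. C \<in> \<C> \<Longrightarrow> subgroup C G \<and> C \<subseteq> K"
    and c: "c \<in> K" "c [^] (p ^ Suc n) = \<one>"
      "c [^] (p ^ n) \<notin> ppw (Suc n) K <#> generate G (\<Union>C\<in>\<C>. C)"
  shows "pure_independent (insert (generate G {c}) \<C>)"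
  unfolding pure_independent_def
proof (intro allI impI ballI)
  let ?B = "generate G (\<Union>C\<in>\<C>. C)" and ?C = "generate G {c}"
  have cc: "c \<in> carrier G" using subgroup.mem_carrier[OF K(1) c(1)] .
  have C: "subgroup ?C G" using cc by (intro generate_is_subgroup) simp
  have CK: "?C \<subseteq> K" using c(1) by (intro generate_subgroup_incl K) simp
  have B: "subgroup ?B G" using sub subgroup.subset by (intro generate_is_subgroup) blast
  have BK: "?B \<subseteq> K" using sub by (intro generate_subgroup_incl K) blast
  fix F f m D
  assume F: "finite F" "F \<subseteq> insert ?C \<C>" "\<forall>C\<in>F. f C \<in> C"
    and prod: "finprod G f F \<in> ppw m (carrier G)" and D: "D \<in> F"
  show "f D \<in> ppw m D"
  proof (cases "?C \<in> F")
    case False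
    then have "F \<subseteq> \<C>" using F(2) by blast
    then show ?thesis using pure_independentD[OF ind F(1) _ F(3) prod D] by blast
  next
    case True
    let ?F = "F - {?C}" and ?b = "finprod G f (F - {?C})"
    have F': "finite ?F" "?F \<subseteq> \<C>" "\<forall>C\<in>?F. f C \<in> C" using F by auto
    have fC: "f ?C \<in> ?C" using F(3) True by blast
    have fc: "f E \<in> carrier G" if "E \<in> F" for E
    proof -
      have "E \<in> insert ?C \<C>" using that F(2) by blast
      then have "subgroup E G" using sub C by auto
      then show ?thesis using F(3) that by (intro subgroup.mem_carrier[of E]) simp_all
    qed
    have "f E \<in> ?B" if "E \<in> ?F" for E
      using F' that by (intro generate.incl) auto
    then have bB: "?b \<in> ?B" by (rule subgroup_finprod_closed[OF B])
    have bc: "?b \<in> carrier G" using subgroup.mem_carrier[OF B bB] .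
    have "finprod G f F = f ?C \<otimes> ?b"
      using finprod_insert[of ?F ?C f] F(1) fc True by (simp add: insert_absorb)
    then have fb: "f ?C \<otimes> ?b \<in> ppw m (carrier G)" using prod by simp
    moreover have "f ?C \<otimes> ?b \<in> K" using fC bB CK BK subgroup.m_closed[OF K(1)] by blast
    ultimately have "f ?C \<otimes> ?b \<in> ppw m K" using K(2) by blast
    then have "f ?C \<otimes> ?b \<otimes> inv ?b \<in> ppw m K <#> ?B"
      using subgroup.m_inv_closed[OF B bB] by (intro set_multI)
    then have "f ?C \<in> ppw m K <#> ?B" using fc[OF True] bc by (simp add: m_assoc)
    moreover obtain t :: int where t: "f ?C = c [^] t" using fC generate_pow[OF cc] by auto
    ultimately have fCm: "f ?C \<in> ppw m ?C" using cyclic_pure_mod[OF K(1) B c] by simp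
    then have "f ?C \<in> ppw m (carrier G)" using ppw_mono[OF subgroup.subset[OF C]] by blast
    then have "?b \<in> ppw m (carrier G)"
      using subgroup_inv_mult_mem[OF subgroup_ppw[OF subgroup_self] _ bc fb] by blast
    then show ?thesis
      using pure_independentD[OF ind F'] fCm D by blast
  qed
qed

lemma ex_maximal_pure_independent:
  obtains \<C> where "pure_independent \<C>" "\<And>C. C \<in> \<C> \<Longrightarrow> \<exists>c\<in>K. C = generate G {c}"
    "\<And>c. c \<in> K \<Longrightarrow> pure_independent (insert (generate G {c}) \<C>) \<Longrightarrow> generate G {c} \<in> \<C>"
proof -
  define \<F> where "\<F> = {\<C>. pure_independent \<C> \<and> \<C> \<subseteq> (\<lambda>c. generate G {c}) ` K}"
  have "\<exists>M\<in>\<F>. \<forall>N\<in>\<F>. M \<subseteq> N \<longrightarrow> N = M"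
  proof (rule subset_Zorn_nonempty)
    have "{} \<in> \<F>" by (simp add: \<F>_def pure_independent_def)
    then show "\<F> \<noteq> {}" by blast
    fix \<A> assume \<A>: "\<A> \<noteq> {}" "subset.chain \<F> \<A>"
    then have mem: "\<And>H. H \<in> \<A> \<Longrightarrow> H \<in> \<F>" by (auto simp: subset.chain_def)
    have "pure_independent (\<Union>\<A>)"
      unfolding pure_independent_def
    proof (intro allI impI ballI)
      fix F f n C
      assume F: "finite F" "F \<subseteq> \<Union>\<A>" "\<forall>C\<in>F. f C \<in> C" "finprod G f F \<in> ppw n (carrier G)" "C \<in> F"
      obtain H where H: "H \<in> \<A>" "F \<subseteq> H"
        using finite_subset_Union_chain[OF F(1,2) \<A>] by blast
      then have "pure_independent H" using mem[OF H(1)] by (simp add: \<F>_def)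
      then show "f C \<in> ppw n C" using F(1) H(2) F(3-5) by (rule pure_independentD)
    qed
    moreover have "\<Union>\<A> \<subseteq> (\<lambda>c. generate G {c}) ` K" using mem unfolding \<F>_def by blast
    ultimately show "\<Union>\<A> \<in> \<F>" by (simp add: \<F>_def)
  qed
  then obtain \<C> where \<C>: "\<C> \<in> \<F>" "\<And>N. N \<in> \<F> \<Longrightarrow> \<C> \<subseteq> N \<Longrightarrow> N = \<C>" by metis
  show ?thesis
  proof (rule that[of \<C>])
    show "pure_independent \<C>" using \<C>(1) by (simp add: \<F>_def)
    show "\<exists>c\<in>K. C = generate G {c}" if "C \<in> \<C>" for C using \<C>(1) that by (auto simp: \<F>_def)
    fix c assume "c \<in> K" "pure_independent (insert (generate G {c}) \<C>)"
    then have "insert (generate G {c}) \<C> \<in> \<F>" using \<C>(1) by (simp add: \<F>_def)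
    then show "generate G {c} \<in> \<C>" using \<C>(2) by blast
  qed
qed

lemma cyclic_group_generate:
  assumes "c \<in> carrier G" shows "cyclic_group (G\<lparr>carrier := generate G {c}\<rparr>)"
proof -
  have C: "subgroup (generate G {c}) G" using assms by (intro generate_is_subgroup) simp
  interpret C: group "G\<lparr>carrier := generate G {c}\<rparr>" using C by (rule subgroup_imp_group)
  have c: "c \<in> generate G {c}" by (simp add: generate.incl)
  have "generate G {c} = range (\<lambda>n::int. c [^] n)"
    using generate_pow[OF assms] by auto
  also have "\<dots> = range (\<lambda>n::int. c [^]\<^bsub>G\<lparr>carrier := generate G {c}\<rparr>\<^esub> n)"
    using int_pow_consistent[OF C c] by simp
  finally have "generate G {c} = range (\<lambda>n::int. c [^]\<^bsub>G\<lparr>carrier := generate G {c}\<rparr>\<^esub> n)" .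
  then show ?thesis unfolding C.cyclic_group using c by auto
qed

theorem ex_basic_subgroup:
  assumes K: "subgroup K G" and pure: "\<And>n. ppw n (carrier G) \<inter> K \<subseteq> ppw n K"
    and div: "carrier G \<subseteq> ppw 1 (carrier G) <#> K"
  obtains B where "basic_subgroup G B" "B \<subseteq> K"
proof -
  note Kc = subgroup.mem_carrier[OF K]
  obtain \<C> where ind: "pure_independent \<C>" and cyc: "\<And>C. C \<in> \<C> \<Longrightarrow> \<exists>c\<in>K. C = generate G {c}"
    and max: "\<And>c. c \<in> K \<Longrightarrow> pure_independent (insert (generate G {c}) \<C>) \<Longrightarrow> generate G {c} \<in> \<C>"
    using ex_maximal_pure_independent by blast
  define B where "B = generate G (\<Union>C\<in>\<C>. C)"
  have sub: "subgroup C G \<and> C \<subseteq> K" if "C \<in> \<C>" for C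
  proof -
    obtain c where c: "c \<in> K" "C = generate G {c}" using cyc[OF \<open>C \<in> \<C>\<close>] by blast
    have "subgroup (generate G {c}) G" using Kc[OF c(1)] by (intro generate_is_subgroup) simp
    moreover have "generate G {c} \<subseteq> K" using c(1) by (intro generate_subgroup_incl K) simp
    ultimately show ?thesis using c(2) by simp
  qed
  have B: "subgroup B G" unfolding B_def
    using sub subgroup.subset by (intro generate_is_subgroup) blast
  have BK: "B \<subseteq> K" unfolding B_def using sub by (intro generate_subgroup_incl K) blast
  have pureB: "ppw n (carrier G) \<inter> B \<subseteq> ppw n B" for n
    unfolding B_def using pure_independent_pure[OF ind] sub by blast
  have "y \<in> ppw m K <#> B" if y: "y \<in> K" "y [^] p \<in> B" for y m
  proof (rule ccontr)
    assume not: "y \<notin> ppw m K <#> B"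
    define k where "k = (LEAST k. y \<notin> ppw k K <#> B)"
    have k: "y \<notin> ppw k K <#> B" unfolding k_def using not by (rule LeastI)
    have "k \<noteq> 0" using k y(1) set_mult_subset_left[OF K B] by (metis ppw_0[OF K] subsetD)
    then obtain n where n: "k = Suc n" by (metis not0_implies_Suc)
    have "y \<in> ppw n K <#> B"
      using not_less_Least[of n "\<lambda>k. y \<notin> ppw k K <#> B"] n by (simp add: k_def)
    then obtain v b where v: "v \<in> ppw n K" "b \<in> B" "y = v \<otimes> b" by (rule set_multE)
    obtain z where z: "z \<in> K" "v = z [^] (p ^ n)" using v(1) by (rule ppwE)
    have zc: "z \<in> carrier G" "b \<in> carrier G" using z(1) v(2) Kc BK by blast+
    have "b [^] p \<otimes> z [^] (p ^ Suc n) = y [^] p"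
      using v(3) z(2) zc by (simp add: nat_pow_distrib pow_Suc_p m_comm del: power_Suc)
    then have "b [^] p \<otimes> z [^] (p ^ Suc n) \<in> B" using y(2) by simp
    then have "z [^] (p ^ Suc n) \<in> B"
      using subgroup_inv_mult_mem[OF B subgroup_nat_pow_closed[OF B v(2)]] zc by blast
    then have "z [^] (p ^ Suc n) \<in> ppw (Suc n) B"
      using pureB ppwI[OF zc(1)] by blast
    then obtain b' where b': "b' \<in> B" "z [^] (p ^ Suc n) = b' [^] (p ^ Suc n)" by (rule ppwE)
    have bc': "b' \<in> carrier G" using b'(1) BK Kc by blast
    define c where "c = z \<otimes> inv b'"
    have c: "c \<in> K" unfolding c_def
      using z(1) b'(1) BK K by (auto intro: subgroup.m_closed subgroup.m_inv_closed)
    have c1: "c [^] (p ^ Suc n) = \<one>"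
      using zc bc' b'(2) by (simp add: c_def nat_pow_distrib nat_pow_inv del: power_Suc)
    have cc: "c \<in> carrier G" using Kc[OF c] .
    have c2: "c [^] (p ^ n) \<notin> ppw (Suc n) K <#> B"
    proof
      assume "c [^] (p ^ n) \<in> ppw (Suc n) K <#> B"
      moreover have "b' [^] (p ^ n) \<otimes> b \<in> ppw (Suc n) K <#> B"
        using subgroup.m_closed[OF B subgroup_nat_pow_closed[OF B b'(1)] v(2)]
          set_mult_subset_right[OF subgroup_ppw[OF K] B] by blast
      ultimately have "c [^] (p ^ n) \<otimes> (b' [^] (p ^ n) \<otimes> b) \<in> ppw (Suc n) K <#> B"
        by (rule subgroup.m_closed[OF mult_subgroups[OF subgroup_ppw[OF K] B]])
      moreover have "c [^] (p ^ n) \<otimes> (b' [^] (p ^ n) \<otimes> b) = y"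
      proof -
        have "c \<otimes> b' = z" using zc bc' by (simp add: c_def m_assoc)
        then have "c [^] (p ^ n) \<otimes> b' [^] (p ^ n) = v" using cc bc' z(2) by (metis nat_pow_distrib)
        then show ?thesis using cc bc' zc v(3) by (simp add: m_assoc[symmetric])
      qed
      ultimately show False using k n by simp
    qed
    have "generate G {c} \<in> \<C>"
      using max[OF c] pure_independent_insert[OF K pure ind sub c c1] c2 by (simp add: B_def)
    then have "c \<in> B" unfolding B_def by (auto intro!: generate.incl)
    then have "c [^] (p ^ n) \<in> B" by (rule subgroup_nat_pow_closed[OF B])
    then show False using c2 set_mult_subset_right[OF subgroup_ppw[OF K] B] by blast
  qed
  then have KB: "K \<subseteq> ppw 1 K <#> B" by (intro divisible_of_socle K B BK)
  have "carrier G \<subseteq> ppw 1 (carrier G) <#> B"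
  proof
    fix x assume "x \<in> carrier G"
    then obtain v k where v: "v \<in> ppw 1 (carrier G)" "k \<in> K" "x = v \<otimes> k"
      using div by (blast elim: set_multE)
    obtain w b where w: "w \<in> ppw 1 K" "b \<in> B" "k = w \<otimes> b"
      using v(2) KB by (blast elim: set_multE)
    have P: "subgroup (ppw 1 (carrier G)) G" by (intro subgroup_ppw subgroup_self)
    have w1: "w \<in> ppw 1 (carrier G)" using w(1) ppw_mono[OF subgroup.subset[OF K]] by blast
    have "v \<otimes> w \<in> ppw 1 (carrier G)" using subgroup.m_closed[OF P v(1) w1] .
    moreover have "x = v \<otimes> w \<otimes> b"
      using v w subgroup.mem_carrier[OF P] w1 subgroup.mem_carrier[OF B] by (simp add: m_assoc)
    ultimately show "x \<in> ppw 1 (carrier G) <#> B" using w(2) by (simp add: set_multI)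
  qed
  then have "divisible_group (G Mod B)" by (intro divisible_quotientI B)
  moreover have "pure_subgroup G B" by (intro pure_subgroupI B pureB)
  moreover have "direct_sum_of_cyclics G B"
    unfolding direct_sum_of_cyclics_def internal_direct_sum_iff
  proof (intro exI[of _ \<C>] conjI ballI allI impI)
    show "cyclic_group (G\<lparr>carrier := C\<rparr>)" if "C \<in> \<C>" for C
      using cyc[OF that] cyclic_group_generate Kc by blast
    show "f C = \<one>" if "finite F" "F \<subseteq> \<C>" "\<forall>C\<in>F. f C \<in> C" "finprod G f F = \<one>" "C \<in> F" for F f C
      using pure_independent_independent[OF ind _ that] cyc Kc by blast
  qed (use sub B_def in auto)
  ultimately show ?thesis using that BK by (simp add: basic_subgroup_def)
qed

section \<open>Large subgroups\<close>

lemma large_subgroup_mult: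
  assumes L: "large_subgroup G L" and K: "subgroup K G"
    "\<And>n. ppw n (carrier G) \<inter> K \<subseteq> ppw n K" "carrier G \<subseteq> ppw 1 (carrier G) <#> K"
  shows "carrier G \<subseteq> L <#> K"
proof -
  obtain B where B: "basic_subgroup G B" "B \<subseteq> K" using ex_basic_subgroup[OF K] by blast
  then have "carrier G = L <#> B" using L by (simp add: large_subgroup_def)
  also have "\<dots> \<subseteq> L <#> K" using B(2) unfolding set_mult_def by blast
  finally show ?thesis .
qed

lemma divisible_complement:
  assumes D: "subgroup D G" "\<And>n. D \<subseteq> ppw n D"
  obtains K where "subgroup K G" "K \<inter> D \<subseteq> {\<one>}" "carrier G \<subseteq> D <#> K"
    "\<And>n. ppw n (carrier G) \<inter> K \<subseteq> ppw n K" "carrier G \<subseteq> ppw 1 (carrier G) <#> K"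
proof -
  obtain K where K: "subgroup K G" "{\<one>} \<subseteq> K" "K \<inter> D \<subseteq> {\<one>}"
    "\<forall>x\<in>carrier G. x [^] p \<in> K \<longrightarrow> x \<in> D <#> K"
    using ex_maximal_disjoint_subgroup[OF prime_p triv_subgroup D(1) Int_lower1] by metis
  have DK: "subgroup (D <#> K) G" using D(1) K(1) by (rule mult_subgroups)
  note Dc = subgroup.mem_carrier[OF D(1)] and Kc = subgroup.mem_carrier[OF K(1)]
  have "x \<in> D <#> K" if "x \<in> carrier G" "x [^] (p ^ m) \<in> K" for m x
    using that
  proof (induction m arbitrary: x)
    case 0
    then show ?case using set_mult_subset_right[OF D(1) K(1)] by auto
  next
    case (Suc m)
    have "x [^] p \<in> D <#> K"
      using Suc.prems by (intro Suc.IH) (simp_all add: pow_p_Suc del: power_Suc)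
    then obtain d k where dk: "d \<in> D" "k \<in> K" "x [^] p = d \<otimes> k" by (rule set_multE)
    have "d \<in> ppw 1 D" using D(2) dk(1) by blast
    then obtain d' where d': "d' \<in> D" "d = d' [^] p" by (auto elim: ppwE)
    have "(inv d' \<otimes> x) [^] p = inv d \<otimes> (d \<otimes> k)"
      using Suc.prems(1) Dc[OF d'(1)] d'(2) dk(3) by (simp add: nat_pow_distrib nat_pow_inv)
    also have "\<dots> = k" using Dc[OF dk(1)] Kc[OF dk(2)] by (simp add: m_assoc[symmetric])
    finally have "inv d' \<otimes> x \<in> D <#> K"
      using K(4) Suc.prems(1) Dc[OF d'(1)] dk(2) by simp
    moreover have "d' \<in> D <#> K" using d'(1) set_mult_subset_left[OF D(1) K(1)] by blast
    ultimately have "d' \<otimes> (inv d' \<otimes> x) \<in> D <#> K" using subgroup.m_closed[OF DK] by blast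
    then show ?case using Dc[OF d'(1)] Suc.prems(1) by (simp add: m_assoc[symmetric])
  qed
  then have cover: "carrier G \<subseteq> D <#> K"
    using torsion subgroup.one_closed[OF K(1)] by (metis subsetI)
  show ?thesis
  proof (rule that[OF K(1,3) cover])
    show "ppw n (carrier G) \<inter> K \<subseteq> ppw n K" for n
    proof
      fix g assume g: "g \<in> ppw n (carrier G) \<inter> K"
      then obtain x where x: "x \<in> carrier G" "g = x [^] (p ^ n)" by (blast elim: ppwE)
      obtain d k where dk: "d \<in> D" "k \<in> K" "x = d \<otimes> k" using cover x(1) by (blast elim: set_multE)
      note c = Dc[OF dk(1)] Kc[OF dk(2)]
      have gdk: "g = k [^] (p ^ n) \<otimes> d [^] (p ^ n)"
        using x(2) dk(3) c by (simp add: nat_pow_distrib m_comm)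
      have "k [^] (p ^ n) \<in> K" using dk(2) by (rule subgroup_nat_pow_closed[OF K(1)])
      then have "d [^] (p ^ n) \<in> K"
        using subgroup_inv_mult_mem[OF K(1)] g gdk c by (metis IntD2 nat_pow_closed)
      moreover have "d [^] (p ^ n) \<in> D" using dk(1) by (rule subgroup_nat_pow_closed[OF D(1)])
      ultimately have "d [^] (p ^ n) = \<one>" using K(3) by blast
      then show "g \<in> ppw n K" using gdk c dk(2) by (simp add: ppwI)
    qed
    have "D \<subseteq> ppw 1 (carrier G)" using D(2) ppw_mono[OF subgroup.subset[OF D(1)]] by blast
    then show "carrier G \<subseteq> ppw 1 (carrier G) <#> K" using cover unfolding set_mult_def by blast
  qed
qed

lemma bounded_soc_ppw_divisible:
  assumes "ppw N (carrier G) \<inter> soc \<subseteq> pomega (carrier G)"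
  shows "ppw N (carrier G) \<subseteq> ppw n (ppw N (carrier G))"
proof -
  let ?D = "ppw N (carrier G)"
  have D: "subgroup ?D G" by (intro subgroup_ppw subgroup_self)
  have one: "H <#> {\<one>} = H" if "subgroup H G" for H
    using subgroup.subset[OF that] by (force simp: set_mult_def)
  have "?D \<subseteq> ppw 1 ?D <#> {\<one>}"
  proof (rule divisible_of_socle[OF D triv_subgroup])
    show "{\<one>} \<subseteq> ?D" using subgroup.one_closed[OF D] by simp
    fix y n assume "y \<in> ?D" "y [^] p \<in> {\<one>}"
    then have "y \<in> pomega (carrier G)"
      using assms subgroup.mem_carrier[OF D] by (auto simp: p_socle_def)
    then have "y \<in> ppw (N + n) (carrier G)" using pomega_subset_ppw by blast
    then show "y \<in> ppw n ?D <#> {\<one>}"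
      by (simp add: one[OF subgroup_ppw[OF subgroup_self]] ppw_ppw[OF subgroup_self])
  qed
  then have "?D \<subseteq> ppw n ?D <#> {\<one>}" by (rule ppw_mult_cover[OF D triv_subgroup])
  then show ?thesis by (simp add: one[OF subgroup_ppw[OF D]])
qed

text \<open>In the bounded case, \<open>G = D \<oplus> K\<close> with \<open>D = p\<^sup>N G\<close> divisible, and \<open>G = L + K\<close>.\<close>

lemma large_subgroup_bounded_case:
  assumes L: "large_subgroup G L" and N: "ppw N (carrier G) \<inter> soc \<subseteq> pomega (carrier G)"
  shows "pomega (carrier G) \<subseteq> ppw k L"
proof -
  have sL: "subgroup L G" using L by (simp add: large_subgroup_def)
  let ?D = "ppw N (carrier G)"
  have D: "subgroup ?D G" by (intro subgroup_ppw subgroup_self)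
  obtain K where K: "subgroup K G" "K \<inter> ?D \<subseteq> {\<one>}" "carrier G \<subseteq> ?D <#> K"
    "\<And>n. ppw n (carrier G) \<inter> K \<subseteq> ppw n K" "carrier G \<subseteq> ppw 1 (carrier G) <#> K"
    using divisible_complement[OF D bounded_soc_ppw_divisible[OF N]] by blast
  have cover: "carrier G \<subseteq> L <#> K" by (rule large_subgroup_mult[OF L K(1,4,5)])
  have "?D \<subseteq> ppw N L"
  proof
    fix y assume "y \<in> ?D"
    then obtain x where x: "x \<in> carrier G" "y = x [^] (p ^ N)" by (rule ppwE)
    obtain l k where lk: "l \<in> L" "k \<in> K" "x = l \<otimes> k" using cover x(1) by (blast elim: set_multE)
    have c: "l \<in> carrier G" "k \<in> carrier G"
      using subgroup.mem_carrier[OF sL lk(1)] subgroup.mem_carrier[OF K(1) lk(2)] .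
    have "k [^] (p ^ N) = \<one>"
      using K(2) ppwI[OF c(2)] subgroup_nat_pow_closed[OF K(1) lk(2)] by blast
    then have "y = l [^] (p ^ N)" using x(2) lk(3) c by (simp add: nat_pow_distrib)
    then show "y \<in> ppw N L" using lk(1) by (simp add: ppwI)
  qed
  then have "ppw k ?D \<subseteq> ppw (N + k) L" using ppw_mono[of ?D "ppw N L" k] ppw_ppw[OF sL] by simp
  then have "ppw (N + k) (carrier G) \<subseteq> ppw (N + k) L" by (simp add: ppw_ppw[OF subgroup_self])
  then show ?thesis
    using pomega_subset_ppw[of "carrier G" "N + k"] ppw_antimono[OF sL, of k "N + k"] by auto
qed

lemma ex_unbounded_soc_sequence:
  assumes unb: "\<And>N. \<not> ppw N (carrier G) \<inter> soc \<subseteq> pomega (carrier G)"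
  obtains s m where "\<And>j. s j \<in> soc" "\<And>j. s j \<notin> ppw (m j) (carrier G)"
    "\<And>j. s (Suc j) \<in> ppw (m j) (carrier G)" "\<And>j. s j \<in> ppw j (carrier G)" "strict_mono m"
proof -
  have ex: "\<exists>s m. s \<in> ppw N (carrier G) \<and> s \<in> soc \<and> s \<notin> ppw m (carrier G)" for N
    using unb[of N] by (auto simp: pomega_def)
  define P where "P x \<longleftrightarrow> fst x \<in> soc \<and> fst x \<notin> ppw (snd x) (carrier G)" for x :: "'a \<times> nat"
  have "\<exists>f. \<forall>n. P (f n) \<and> fst (f (Suc n)) \<in> ppw (snd (f n)) (carrier G)"
  proof (rule dependent_nat_choice)
    show "\<exists>x. P x" using ex by (auto simp: P_def)
    show "\<exists>y. P y \<and> fst y \<in> ppw (snd x) (carrier G)" for x using ex[of "snd x"] by (auto simp: P_def)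
  qed
  then obtain f where f: "\<And>n. P (f n)" "\<And>n. fst (f (Suc n)) \<in> ppw (snd (f n)) (carrier G)"
    by blast
  define s m where "s n = fst (f n)" and "m n = snd (f n)" for n
  have s: "s j \<in> soc" "s j \<notin> ppw (m j) (carrier G)" "s (Suc j) \<in> ppw (m j) (carrier G)" for j
    using f by (simp_all add: s_def m_def P_def)
  have less: "m j < m (Suc j)" for j
  proof (rule ccontr)
    assume "\<not> m j < m (Suc j)"
    then have "ppw (m j) (carrier G) \<subseteq> ppw (m (Suc j)) (carrier G)"
      by (intro ppw_antimono subgroup_self) simp
    then show False using s(3)[of j] s(2)[of "Suc j"] by blast
  qed
  have mono: "strict_mono m" using less by (simp add: strict_mono_Suc_iff)
  have "s j \<in> ppw j (carrier G)" for j
  proof (cases j)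
    case 0
    then show ?thesis using socD(1)[OF s(1)] by (simp add: ppw_0[OF subgroup_self])
  next
    case (Suc i)
    have "m 0 \<noteq> 0" using s(1,2)[of 0] socD(1) ppw_0[OF subgroup_self] by metis
    then have "Suc i \<le> m i" using less by (induction i) (auto intro: Suc_leI order_le_less_trans)
    then show ?thesis using s(3)[of i] ppw_antimono[OF subgroup_self] Suc by blast
  qed
  then show ?thesis using that s mono by blast
qed

text \<open>In the unbounded case there is a pure subgroup \<open>K\<close> such that \<open>G/K\<close> is quasicyclic, and \<open>K\<close>
  contains \<open>p\<^sup>\<omega> G\<close> but no \<open>p\<^sup>n G\<close>. It is maximal with respect to avoiding \<open>s\<^sub>0\<close> while identifying
  the socle elements \<open>s\<^sub>j\<close> of increasing heights, so that \<open>s\<^sub>0\<close> has infinite height in \<open>G/K\<close>.\<close>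

lemma ex_dense_pure_subgroup:
  assumes unb: "\<And>N. \<not> ppw N (carrier G) \<inter> soc \<subseteq> pomega (carrier G)"
  obtains K where "subgroup K G" "pomega (carrier G) \<subseteq> K" "\<And>n. \<not> ppw n (carrier G) \<subseteq> K"
    "\<And>n. ppw n (carrier G) \<inter> K \<subseteq> ppw n K" "carrier G \<subseteq> ppw 1 (carrier G) <#> K"
proof -
  let ?P = "\<lambda>n. ppw n (carrier G)"
  obtain s m where s: "\<And>j. s j \<in> soc" "\<And>j. s j \<notin> ?P (m j)" "\<And>j. s (Suc j) \<in> ?P (m j)"
    "\<And>j. s j \<in> ?P j" and m: "strict_mono m"
    using ex_unbounded_soc_sequence[OF unb] by blast
  have P: "subgroup (?P n) G" for n by (intro subgroup_ppw subgroup_self)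
  have sc: "s j \<in> carrier G" for j using socD(1)[OF s(1)] .
  have pow_one: "x [^] t = \<one>" if x: "x \<in> soc" and t: "int p dvd t" for x and t :: int
  proof -
    obtain r where "t = int (p ^ 1) * r" using t by auto
    then show ?thesis using int_p_pow[of x 1 r] socD[OF x] by simp
  qed
  define e where "e j = s 0 \<otimes> inv (s j)" for j
  have e: "e j \<in> soc" for j unfolding e_def
    using s(1) by (intro subgroup.m_closed[OF subgroup_soc] subgroup.m_inv_closed[OF subgroup_soc])
  have ec: "e j \<in> carrier G" for j using socD(1)[OF e] .
  define E where "E = rec_nat {\<one>} (\<lambda>i A. A <#> generate G {e (Suc i)})"
  have E0: "E 0 = {\<one>}" and ESuc: "E (Suc i) = E i <#> generate G {e (Suc i)}" for i
    by (simp_all add: E_def)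
  have gen: "subgroup (generate G {e j}) G" for j using ec by (intro generate_is_subgroup) simp
  have E: "subgroup (E i) G" for i
    by (induction i) (simp_all add: E0 ESuc triv_subgroup mult_subgroups gen)
  have E_Suc: "E i \<subseteq> E (Suc i)" for i unfolding ESuc by (rule set_mult_subset_left[OF E gen])
  then have E_mono: "i \<le> j \<Longrightarrow> E i \<subseteq> E j" for i j by (rule lift_Suc_mono_le)
  have E_triv: "u = \<one> \<and> int p dvd t" if "u \<in> E i" "s 0 [^] t \<otimes> u \<in> ?P (m i)" for i u and t :: int
    using that
  proof (induction i arbitrary: u t)
    case 0
    then have "u = \<one>" by (simp add: E0)
    moreover have "int p dvd t"
      using 0 sc s(2)[of 0] socD(2)[OF s(1)] subgroup.one_closed[OF P] \<open>u = \<one>\<close>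
      by (intro subgroup_prime_pow_dvd[OF P sc s(2) _ _ prime_p]) simp_all
    ultimately show ?case by simp
  next
    case (Suc i)
    let ?s = "s (Suc i)"
    obtain v w where v: "v \<in> E i" "w \<in> generate G {e (Suc i)}" "u = v \<otimes> w"
      using Suc.prems(1) unfolding ESuc by (rule set_multE)
    obtain r :: int where r: "w = e (Suc i) [^] r" using v(2) generate_pow[OF ec] by auto
    have vc: "v \<in> carrier G" using subgroup.mem_carrier[OF E v(1)] .
    have w: "w = s 0 [^] r \<otimes> inv (?s [^] r)"
      unfolding r e_def using sc by (simp add: int_pow_distrib int_pow_inv)
    have eq: "s 0 [^] (t + r) \<otimes> v = (s 0 [^] t \<otimes> u) \<otimes> ?s [^] r"
      unfolding v(3) w using sc vc by (simp add: int_pow_mult m_ac)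
    have "?P (m (Suc i)) \<subseteq> ?P (m i)"
      using m by (intro ppw_antimono subgroup_self) (simp add: strict_mono_less_eq)
    then have "s 0 [^] (t + r) \<otimes> v \<in> ?P (m i)" unfolding eq
      using Suc.prems(2) subgroup_int_pow_closed[OF P s(3)] subgroup.m_closed[OF P] by blast
    then have IH: "v = \<one>" "int p dvd t + r" using Suc.IH[OF v(1)] by auto
    have "s 0 [^] (t + r) = \<one>" using pow_one[OF s(1) IH(2)] .
    then have "\<one> = (s 0 [^] t \<otimes> u) \<otimes> ?s [^] r" using eq IH(1) by simp
    then have "(s 0 [^] t \<otimes> u) \<otimes> ?s [^] r \<in> ?P (m (Suc i))" using subgroup.one_closed[OF P] by metis
    then have "?s [^] r \<in> ?P (m (Suc i))"
      using subgroup_inv_mult_mem[OF P Suc.prems(2)] sc by simp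
    then have "int p dvd r"
      using subgroup_prime_pow_dvd[OF P sc s(2) _ _ prime_p] socD(2)[OF s(1)]
        subgroup.one_closed[OF P] by metis
    moreover from this have "w = \<one>" unfolding r using pow_one[OF e] by blast
    ultimately show ?case using IH v(3) by (simp add: dvd_add_left_iff)
  qed
  let ?U = "pomega (carrier G) <#> (\<Union>i. E i)"
  have UE: "subgroup (\<Union>i. E i) G"
  proof (rule subgroupI)
    show "(\<Union>i. E i) \<subseteq> carrier G" using subgroup.subset[OF E] by blast
    show "(\<Union>i. E i) \<noteq> {}" using subgroup.one_closed[OF E] by blast
    show "inv x \<in> (\<Union>i. E i)" if "x \<in> (\<Union>i. E i)" for x
      using that subgroup.m_inv_closed[OF E] by blast
    fix x y assume "x \<in> (\<Union>i. E i)" "y \<in> (\<Union>i. E i)"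
    then obtain i j where "x \<in> E i" "y \<in> E j" by blast
    then have "x \<in> E (max i j)" "y \<in> E (max i j)"
      using E_mono[of i "max i j"] E_mono[of j "max i j"] by auto
    then show "x \<otimes> y \<in> (\<Union>i. E i)" using subgroup.m_closed[OF E] by blast
  qed
  have W: "subgroup (pomega (carrier G)) G" by (intro subgroup_pomega subgroup_self)
  have U: "subgroup ?U G" using W UE by (rule mult_subgroups)
  have s0U: "s 0 \<notin> ?U"
  proof
    assume "s 0 \<in> ?U"
    then obtain w u i where wu: "w \<in> pomega (carrier G)" "u \<in> E i" "s 0 = w \<otimes> u"
      by (blast elim: set_multE)
    have c: "w \<in> carrier G" "u \<in> carrier G"
      using subgroup.mem_carrier[OF W wu(1)] subgroup.mem_carrier[OF E wu(2)] .
    have "s 0 [^] (1::int) \<otimes> inv u = w" using wu(3) c sc[of 0] by (simp add: m_assoc)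
    then have "s 0 [^] (1::int) \<otimes> inv u \<in> ?P (m i)" using wu(1) pomega_subset_ppw by blast
    then have "int p dvd 1" using E_triv[OF subgroup.m_inv_closed[OF E wu(2)]] by blast
    then show False using prime_p by (metis int_dvd_int_iff not_prime_unit of_nat_1)
  qed
  let ?A = "generate G {s 0}"
  have A: "subgroup ?A G" using sc by (intro generate_is_subgroup) simp
  obtain K where K: "subgroup K G" "?U \<subseteq> K" "K \<inter> ?A \<subseteq> {\<one>}"
    "\<forall>x\<in>carrier G. x [^] p \<in> K \<longrightarrow> x \<in> ?A <#> K"
    using ex_maximal_disjoint_subgroup[OF prime_p U A generate_soc_trivial_Int[OF s(1) s0U U]]
    by metis
  note Kc = subgroup.mem_carrier[OF K(1)]
  have "s 0 \<noteq> \<one>" using s(2)[of 0] subgroup.one_closed[OF P] by metis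
  then have s0K: "s 0 \<notin> K" using K(3) generate.incl[of "s 0" "{s 0}" G] by blast
  have eK: "e j \<in> K" for j
  proof (cases j)
    case 0
    then show ?thesis using sc subgroup.one_closed[OF K(1)] by (simp add: e_def)
  next
    case (Suc i)
    have "e j \<in> generate G {e j}" by (simp add: generate.incl)
    then have "e j \<in> E j" unfolding Suc ESuc using set_mult_subset_right[OF E gen] by blast
    then show ?thesis using K(2) set_mult_subset_right[OF W UE] by blast
  qed
  have lift: "\<exists>h\<in>carrier G. h [^] (p ^ Suc n) = \<one> \<and> (\<exists>k\<in>K. y = h [^] (p ^ n) \<otimes> k)"
    if y: "y \<in> carrier G" "y [^] p \<in> K" for y n
  proof -
    obtain a k where ak: "a \<in> ?A" "k \<in> K" "y = a \<otimes> k" using K(4) y by (blast elim: set_multE)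
    obtain t :: int where t: "a = s 0 [^] t" using ak(1) generate_pow[OF sc] by auto
    obtain c where c: "c \<in> carrier G" "s n = c [^] (p ^ n)" using s(4) by (rule ppwE)
    define h where "h = c [^] t"
    have h: "h \<in> carrier G" using c by (simp add: h_def)
    have pow: "h [^] (p ^ i) = (c [^] (p ^ i)) [^] t" for i
      using c(1) by (simp add: h_def int_pow_pow int_pow_int[symmetric] mult.commute del: of_nat_power)
    have "c [^] (p ^ Suc n) = \<one>" using ppw_soc_mem[OF c(1), of n] s(1)[of n] c(2) by simp
    then have "h [^] (p ^ Suc n) = \<one>" using pow[of "Suc n"] by simp
    moreover have "y = h [^] (p ^ n) \<otimes> (e n [^] t \<otimes> k)"
    proof -
      have "s n \<otimes> e n = s 0" unfolding e_def using sc by (simp add: m_lcomm)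
      then have "a = (s n) [^] t \<otimes> e n [^] t" unfolding t using sc ec by (metis int_pow_distrib)
      then show ?thesis using ak(3) pow[of n] c sc ec Kc[OF ak(2)] by (simp add: m_assoc)
    qed
    moreover have "e n [^] t \<otimes> k \<in> K"
      using subgroup_int_pow_closed[OF K(1) eK] ak(2) subgroup.m_closed[OF K(1)] by blast
    ultimately show ?thesis using h by blast
  qed
  show ?thesis
  proof (rule that[OF K(1)])
    show "pomega (carrier G) \<subseteq> K" using K(2) set_mult_subset_left[OF W UE] by blast
    show "\<not> ?P n \<subseteq> K" for n
    proof
      assume "?P n \<subseteq> K"
      then have "e n \<otimes> s n \<in> K" using s(4) eK subgroup.m_closed[OF K(1)] by blast
      then show False using s0K sc by (simp add: e_def m_assoc)
    qed
    show "carrier G \<subseteq> ppw 1 (carrier G) <#> K"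
    proof (rule divisible_of_socle[OF subgroup_self K(1) subgroup.subset[OF K(1)]])
      fix y n assume "y \<in> carrier G" "y [^] p \<in> K"
      then show "y \<in> ?P n <#> K" using lift[of y n] by (auto intro: set_multI ppwI)
    qed
    have "\<exists>h\<in>carrier G. h [^] (p ^ n) = \<one> \<and> (\<exists>k\<in>K. g = h \<otimes> k)"
      if "g \<in> carrier G" "g [^] (p ^ n) \<in> K" for n g
      using that
    proof (induction n arbitrary: g)
      case 0
      then show ?case by (auto intro!: bexI[of _ \<one>] bexI[of _ g])
    next
      case (Suc n)
      obtain h k where h: "h \<in> carrier G" "h [^] (p ^ Suc n) = \<one>" "k \<in> K"
        "g [^] (p ^ n) = h [^] (p ^ n) \<otimes> k"
        using lift[of "g [^] (p ^ n)" n] Suc.prems by (auto simp: pow_Suc_p simp del: power_Suc)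
      have "(inv h \<otimes> g) [^] (p ^ n) = inv (h [^] (p ^ n)) \<otimes> (h [^] (p ^ n) \<otimes> k)"
        using h Suc.prems(1) by (simp add: nat_pow_distrib nat_pow_inv)
      also have "\<dots> = k" using h(1) Kc[OF h(3)] by (simp add: m_assoc[symmetric])
      finally obtain h' k' where h': "h' \<in> carrier G" "h' [^] (p ^ n) = \<one>" "k' \<in> K"
        "inv h \<otimes> g = h' \<otimes> k'"
        using Suc.IH[of "inv h \<otimes> g"] h Suc.prems(1) by auto
      have "g = h \<otimes> (inv h \<otimes> g)" using h(1) Suc.prems(1) by (simp add: m_assoc[symmetric])
      then have "g = (h \<otimes> h') \<otimes> k'" using h(1) h' Kc[OF h'(3)] by (simp add: m_assoc)
      moreover have "h' [^] (p ^ Suc n) = \<one>" using pow_Suc_p[OF h'(1), of n] h'(2) by simp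
      then have "(h \<otimes> h') [^] (p ^ Suc n) = \<one>"
        using h(1,2) h'(1) by (simp add: nat_pow_distrib del: power_Suc)
      ultimately show ?case using h(1) h'(1,3) by blast
    qed
    note dec = this
    show "?P n \<inter> K \<subseteq> ppw n K" for n
    proof
      fix y assume y: "y \<in> ?P n \<inter> K"
      then obtain g where g: "g \<in> carrier G" "y = g [^] (p ^ n)" by (blast elim: ppwE)
      then obtain h k where hk: "h \<in> carrier G" "h [^] (p ^ n) = \<one>" "k \<in> K" "g = h \<otimes> k"
        using dec[of g n] y by blast
      then have "y = k [^] (p ^ n)" using g(2) Kc[OF hk(3)] by (simp add: nat_pow_distrib)
      then show "y \<in> ppw n K" using hk(3) by (simp add: ppwI)
    qed
  qed
qed

lemma large_subgroup_unbounded_soc: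
  assumes L: "large_subgroup G L"
    and unb: "\<And>N. \<not> ppw N (carrier G) \<inter> soc \<subseteq> pomega (carrier G)"
  shows "\<not> ppw k L \<inter> soc \<subseteq> pomega (carrier G)"
proof
  assume soc: "ppw k L \<inter> soc \<subseteq> pomega (carrier G)"
  have sL: "subgroup L G" and fL: "fully_invariant G L" using L by (simp_all add: large_subgroup_def)
  obtain K where K: "subgroup K G" "pomega (carrier G) \<subseteq> K" "\<And>n. \<not> ppw n (carrier G) \<subseteq> K"
    "\<And>n. ppw n (carrier G) \<inter> K \<subseteq> ppw n K" "carrier G \<subseteq> ppw 1 (carrier G) <#> K"
    using ex_dense_pure_subgroup[OF unb] by blast
  have LK: "ppw k L \<subseteq> K"
    using fully_invariant_subset_pomega[OF fully_invariant_ppw[OF fL sL] subgroup_ppw[OF sL] soc]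
      K(2) by blast
  have "ppw k (carrier G) \<subseteq> K"
  proof
    fix y assume "y \<in> ppw k (carrier G)"
    then obtain x where x: "x \<in> carrier G" "y = x [^] (p ^ k)" by (rule ppwE)
    obtain l h where lh: "l \<in> L" "h \<in> K" "x = l \<otimes> h"
      using large_subgroup_mult[OF L K(1,4,5)] x(1) by (blast elim: set_multE)
    have "y = l [^] (p ^ k) \<otimes> h [^] (p ^ k)"
      using x(2) lh subgroup.mem_carrier[OF sL] subgroup.mem_carrier[OF K(1)]
      by (simp add: nat_pow_distrib)
    moreover have "l [^] (p ^ k) \<in> K" using LK ppwI[OF lh(1)] by blast
    ultimately show "y \<in> K"
      using subgroup.m_closed[OF K(1)] subgroup_nat_pow_closed[OF K(1) lh(2)] by blast
  qed
  then show False using K(3) by blast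
qed

theorem large_subgroup_pomega:
  assumes L: "large_subgroup G L"
  shows "pomega L = pomega (carrier G)"
proof
  have sL: "subgroup L G" and fL: "fully_invariant G L" using L by (simp_all add: large_subgroup_def)
  show "pomega L \<subseteq> pomega (carrier G)"
    using ppw_mono[OF subgroup.subset[OF sL]] unfolding pomega_def by blast
  have "pomega (carrier G) \<subseteq> ppw k L" for k
  proof (cases "\<exists>N. ppw N (carrier G) \<inter> soc \<subseteq> pomega (carrier G)")
    case True
    then show ?thesis using large_subgroup_bounded_case[OF L] by blast
  next
    case False
    then have unb: "\<not> ppw n L \<inter> soc \<subseteq> pomega (carrier G)" for n
      using large_subgroup_unbounded_soc[OF L] by blast
    have inf: "\<not> ppw n (ppw k L) \<inter> soc \<subseteq> pomega (carrier G)" for n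
      using unb by (simp add: ppw_ppw[OF sL])
    show ?thesis
    proof
      fix x assume x: "x \<in> pomega (carrier G)"
      then have "x \<in> carrier G"
        using subgroup.mem_carrier[OF subgroup_pomega[OF subgroup_self]] by blast
      then obtain n where n: "x [^] (p ^ n) = \<one>" using torsion by blast
      obtain N where "\<forall>y\<in>ppw N (carrier G). y [^] (p ^ n) = \<one> \<longrightarrow> y \<in> ppw k L"
        using fully_invariant_contains_torsion[OF fully_invariant_ppw[OF fL sL] subgroup_ppw[OF sL] inf]
        by blast
      then show "x \<in> ppw k L" using n x pomega_subset_ppw by blast
    qed
  qed
  then show "pomega (carrier G) \<subseteq> pomega L" unfolding pomega_def[of L] by blast
qed

lemma ppw_max: "subgroup H G \<Longrightarrow> ppw (max i j) H = ppw i H \<inter> ppw j H"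
  using ppw_antimono[of H i j] ppw_antimono[of H j i] by (cases "i \<le> j") (auto simp: max_def)

lemma large_subgroup_soc:
  assumes L: "large_subgroup G L"
  shows "\<exists>u\<ge>k. ppw k L \<inter> soc = ppw u (carrier G) \<inter> soc"
proof -
  have sL: "subgroup L G" and fL: "fully_invariant G L" using L by (simp_all add: large_subgroup_def)
  have sub: "ppw k L \<subseteq> ppw k (carrier G)" by (rule ppw_mono[OF subgroup.subset[OF sL]])
  have "\<exists>u. ppw k L \<inter> soc = ppw u (carrier G) \<inter> soc"
  proof (cases "ppw k L \<inter> soc \<subseteq> pomega (carrier G)")
    case True
    then obtain N where N: "ppw N (carrier G) \<inter> soc \<subseteq> pomega (carrier G)"
      using large_subgroup_unbounded_soc[OF L] by blast
    have "pomega (carrier G) \<subseteq> ppw k L"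
      using large_subgroup_pomega[OF L] pomega_subset_ppw by blast
    then have "ppw k L \<inter> soc = ppw N (carrier G) \<inter> soc"
      using True N pomega_subset_ppw[of "carrier G" N] by blast
    then show ?thesis by blast
  next
    case False
    then show ?thesis using fully_invariant_soc_cases[OF fully_invariant_ppw[OF fL sL]] by blast
  qed
  then obtain u where u: "ppw k L \<inter> soc = ppw u (carrier G) \<inter> soc" by blast
  then have "ppw k L \<inter> soc = ppw (max k u) (carrier G) \<inter> soc"
    using sub unfolding ppw_max[OF subgroup_self] by blast
  then show ?thesis using max.cobounded1 by blast
qed

lemma large_subgroup_soc_sequence:
  assumes L: "large_subgroup G L"
  obtains u where "mono u" "\<And>k. k \<le> u k" "\<And>k. ppw k L \<inter> soc = ppw (u k) (carrier G) \<inter> soc"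
proof -
  have sL: "subgroup L G" using L by (simp add: large_subgroup_def)
  obtain v where v: "\<And>k. k \<le> v k" "\<And>k. ppw k L \<inter> soc = ppw (v k) (carrier G) \<inter> soc"
    using large_subgroup_soc[OF L] by metis
  define u where "u = rec_nat (v 0) (\<lambda>k a. max a (v (Suc k)))"
  have u: "u 0 = v 0" "\<And>k. u (Suc k) = max (u k) (v (Suc k))" by (simp_all add: u_def)
  have "mono u" by (simp add: mono_iff_le_Suc u)
  moreover have "k \<le> u k" for k using v(1)[of k] by (cases k) (auto simp: u)
  moreover have "ppw k L \<inter> soc = ppw (u k) (carrier G) \<inter> soc" for k
  proof (induction k)
    case (Suc k)
    have "ppw (u (Suc k)) (carrier G) \<inter> soc = (ppw k L \<inter> soc) \<inter> (ppw (Suc k) L \<inter> soc)"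
      unfolding Suc v(2)[of "Suc k"] u(2) ppw_max[OF subgroup_self] by blast
    then show ?case using ppw_antimono[OF sL, of k "Suc k"] by auto
  qed (simp add: u v(2))
  ultimately show ?thesis using that by blast
qed

section \<open>Transfinite powers\<close>

lemma ppow_osuc_ppw:
  "ppow p (G\<lparr>carrier := M\<rparr>) (osuc \<alpha>) = ppw 1 (ppow p (G\<lparr>carrier := M\<rparr>) \<alpha>)"
  by (simp add: ppw_def nat_pow_consistent[symmetric])

lemma ppow_ofin:
  assumes "subgroup M G" shows "ppow p (G\<lparr>carrier := M\<rparr>) (ofin n) = ppw n M"
proof (induction n)
  case 0
  then show ?case using assms by (simp add: ofin_0 ppw_0)
next
  case (Suc n)
  then show ?case using ppw_ppw[OF assms, of 1 n] by (simp add: ofin_Suc ppow_osuc_ppw del: ppow.simps)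
qed

lemma subgroup_ppow:
  assumes "subgroup M G" shows "subgroup (ppow p (G\<lparr>carrier := M\<rparr>) \<alpha>) G"
proof (induction \<alpha> rule: less_induct)
  case (less \<alpha>)
  show ?case
  proof (cases \<alpha> rule: ordinal_cases)
    case 1
    then show ?thesis using assms by simp
  next
    case (2 \<beta>)
    then show ?thesis using less[of \<beta>] less_osuc[of \<beta>] by (simp add: ppow_osuc_ppw subgroup_ppw del: ppow.simps)
  next
    case 3
    then have "0 < \<alpha>" using zero_ordinal_le[of \<alpha>] by (auto simp: is_limit_def order_le_less)
    then show ?thesis unfolding ppow.simps(3)[OF 3] using less by (intro subgroups_Inter) auto
  qed
qed

lemma ppow_infinite_eq:
  assumes L: "subgroup L G" "pomega L = pomega (carrier G)" and "\<alpha> \<notin> range ofin"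
  shows "ppow p (G\<lparr>carrier := L\<rparr>) \<alpha> = ppow p G \<alpha>"
  using assms(3)
proof (induction \<alpha> rule: less_induct)
  case (less \<alpha>)
  have G: "G\<lparr>carrier := carrier G\<rparr> = G" by simp
  show ?case
  proof (cases \<alpha> rule: ordinal_cases)
    case 1
    then show ?thesis using less.prems ofin_0 by (metis rangeI)
  next
    case (2 \<beta>)
    then have "ppow p (G\<lparr>carrier := L\<rparr>) \<beta> = ppow p G \<beta>"
      using less less_osuc[of \<beta>] by (simp add: osuc_mem_ofin_iff)
    then show ?thesis
      using ppow_osuc_ppw[of L \<beta>] ppow_osuc_ppw[of "carrier G" \<beta>] unfolding 2 G by simp
  next
    case 3
    have sub: "(\<Inter>\<beta>\<in>{..<\<alpha>}. ppow p (G\<lparr>carrier := M\<rparr>) \<beta>) \<subseteq> (\<Inter>\<beta>\<in>{..<\<alpha>}. ppow p (G\<lparr>carrier := N\<rparr>) \<beta>)"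
      if M: "subgroup M G" and N: "subgroup N G" and MN: "pomega M = pomega N"
        and IH: "\<And>\<beta>. \<beta> < \<alpha> \<Longrightarrow> \<beta> \<notin> range ofin \<Longrightarrow>
          ppow p (G\<lparr>carrier := M\<rparr>) \<beta> = ppow p (G\<lparr>carrier := N\<rparr>) \<beta>" for M N
    proof (intro subsetI INT_I)
      fix x \<beta> assume x: "x \<in> (\<Inter>\<beta>\<in>{..<\<alpha>}. ppow p (G\<lparr>carrier := M\<rparr>) \<beta>)" and \<beta>: "\<beta> \<in> {..<\<alpha>}"
      show "x \<in> ppow p (G\<lparr>carrier := N\<rparr>) \<beta>"
      proof (cases "\<beta> \<in> range ofin")
        case True
        have "x \<in> ppw k M" for k
          using x ofin_less_infinite[OF less.prems, of k] ppow_ofin[OF M, of k] by blast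
        then have "x \<in> pomega N" unfolding MN[symmetric] by (simp add: pomega_def)
        then show ?thesis using True ppow_ofin[OF N] pomega_subset_ppw by blast
      next
        case False
        then show ?thesis using x \<beta> IH[of \<beta>] by blast
      qed
    qed
    have IH: "ppow p (G\<lparr>carrier := L\<rparr>) \<beta> = ppow p (G\<lparr>carrier := carrier G\<rparr>) \<beta>"
      if "\<beta> < \<alpha>" "\<beta> \<notin> range ofin" for \<beta> using less.IH[OF that] by simp
    have "(\<Inter>\<beta>\<in>{..<\<alpha>}. ppow p (G\<lparr>carrier := L\<rparr>) \<beta>) =
        (\<Inter>\<beta>\<in>{..<\<alpha>}. ppow p (G\<lparr>carrier := carrier G\<rparr>) \<beta>)"
      using sub[OF L(1) subgroup_self L(2) IH]
        sub[OF subgroup_self L(1) L(2)[symmetric] IH[symmetric]] by (rule equalityI)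
    then show ?thesis by (simp add: ppow.simps(3)[OF 3])
  qed
qed

section \<open>Summability\<close>

lemma summable_iff_free_filtration:
  "summable_group p G \<longleftrightarrow> free_filtration (\<lambda>\<alpha> :: 'a ordinal. ppow p G \<alpha> \<inter> soc)"
proof
  let ?V = "\<lambda>\<alpha> :: 'a ordinal. ppow p G \<alpha> \<inter> soc" and ?len = "group_length p G"
  have G: "G\<lparr>carrier := carrier G\<rparr> = G" by simp
  have V: "subgroup (?V \<alpha>) G" for \<alpha>
    using subgroup_ppow[OF subgroup_self, of \<alpha>] subgroup_soc unfolding G by (rule subgroups_Inter_pair)
  have V_mono: "\<alpha> \<le> \<beta> \<Longrightarrow> ?V \<beta> \<subseteq> ?V \<alpha>" for \<alpha> \<beta>
    using ppow_antimono[OF is_monoid] by blast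
  have V0: "?V 0 = soc" using socD(1) by auto
  {
    assume "summable_group p G"
    then obtain S :: "'a ordinal \<Rightarrow> 'a set" where
      S: "internal_direct_sum G {..<?len} S soc"
        "\<And>\<alpha>. \<alpha> < ?len \<Longrightarrow> S \<alpha> - {\<one>} \<subseteq> ppow p G \<alpha> - ppow p G (osuc \<alpha>)"
      unfolding summable_group_def by blast
    have sub: "subgroup (S \<alpha>) G" if "\<alpha> < ?len" for \<alpha> using S(1) that by (simp add: internal_direct_sum_iff)
    have span: "soc = generate G (\<Union>\<alpha>\<in>{..<?len}. S \<alpha>)" using S(1) by (simp add: internal_direct_sum_iff)
    define T where "T \<alpha> = (if \<alpha> < ?len then S \<alpha> else {\<one>})" for \<alpha>
    have "subgroup (T \<alpha>) G" for \<alpha> using sub triv_subgroup by (simp add: T_def)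
    moreover have "T \<alpha> \<subseteq> ?V \<alpha>" for \<alpha>
    proof (cases "\<alpha> < ?len")
      case True
      then have "S \<alpha> \<subseteq> soc" unfolding span by (auto intro: generate.incl)
      moreover have "S \<alpha> \<subseteq> ppow p G \<alpha>" using S(2)[OF True] subgroup.one_closed[OF V[of \<alpha>]] by blast
      ultimately show ?thesis using True by (simp add: T_def)
    next
      case False
      then show ?thesis using subgroup.one_closed[OF V[of \<alpha>]] by (simp add: T_def)
    qed
    moreover have "T \<alpha> \<inter> ?V (osuc \<alpha>) \<subseteq> {\<one>}" for \<alpha> using S(2)[of \<alpha>] by (auto simp: T_def)
    moreover have "?V 0 \<subseteq> generate G (\<Union>\<alpha>. T \<alpha>)"
      unfolding V0 by (subst span, intro mono_generate) (auto simp: T_def)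
    ultimately show "free_filtration ?V" unfolding free_filtration_def by blast
  next
    assume "free_filtration ?V"
    then obtain S where S: "\<And>\<alpha>. subgroup (S \<alpha>) G" "\<And>\<alpha>. S \<alpha> \<subseteq> ?V \<alpha>"
      "\<And>\<alpha>. S \<alpha> \<inter> ?V (osuc \<alpha>) \<subseteq> {\<one>}" and span: "soc \<subseteq> generate G (\<Union>\<alpha>. S \<alpha>)"
      unfolding free_filtration_def V0 by metis
    have stable0: "ppow p G (osuc ?len) = ppow p G ?len"
      unfolding group_length_def using LeastI_ex[OF ex_ppow_stable[OF is_monoid, of p]] by simp
    have stable: "ppow p G \<alpha> = ppow p G ?len" if "?len \<le> \<alpha>" for \<alpha>
      using that
    proof (induction \<alpha> rule: less_induct)
      case (less \<alpha>)
      show ?case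
      proof (cases "\<alpha> = ?len")
        case False
        then have lt: "?len < \<alpha>" using less.prems by simp
        show ?thesis
        proof (cases \<alpha> rule: ordinal_cases)
          case 1
          then show ?thesis using lt zero_ordinal_le[of "?len"] by simp
        next
          case (2 \<beta>)
          then have "?len \<le> \<beta>" using lt osuc_le[of \<beta> "?len"] by (meson not_less)
          then have "ppow p G \<beta> = ppow p G ?len" using less.IH[of \<beta>] less_osuc[of \<beta>] 2 by simp
          then show ?thesis using stable0 unfolding 2 by simp
        next
          case 3
          have "ppow p G ?len \<subseteq> ppow p G \<beta>" if "\<beta> < \<alpha>" for \<beta>
          proof (cases "?len \<le> \<beta>")
            case True
            then show ?thesis using less.IH[OF that] by simp
          next
            case False
            then show ?thesis by (intro ppow_antimono is_monoid) simp
          qed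
          then show ?thesis using lt 3 by auto
        qed
      qed simp
    qed
    have triv: "S \<alpha> \<subseteq> {\<one>}" if "\<not> \<alpha> < ?len" for \<alpha>
    proof -
      have "?len \<le> \<alpha>" "?len \<le> osuc \<alpha>" using that less_osuc[of \<alpha>] by auto
      then have "?V (osuc \<alpha>) = ?V \<alpha>" using stable by metis
      then show ?thesis using S(2,3)[of \<alpha>] by blast
    qed
    let ?Z = "generate G (\<Union>\<alpha>\<in>{..<?len}. S \<alpha>)"
    have Z: "subgroup ?Z G" using subgroup.subset[OF S(1)] by (intro generate_is_subgroup) blast
    have "S \<alpha> \<subseteq> ?Z" for \<alpha>
    proof (cases "\<alpha> < ?len")
      case True
      then show ?thesis by (auto intro: generate.incl)
    next
      case False
      then show ?thesis using triv subgroup.one_closed[OF Z] by blast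
    qed
    then have "generate G (\<Union>\<alpha>. S \<alpha>) \<subseteq> ?Z" by (intro generate_subgroup_incl Z) blast
    moreover have "?Z \<subseteq> soc" using S(2) by (intro generate_subgroup_incl subgroup_soc) blast
    ultimately have span': "soc = ?Z" using span by blast
    have "internal_direct_sum G {..<?len} S soc"
      unfolding internal_direct_sum_iff
    proof (intro conjI ballI allI impI)
      fix F f \<alpha> assume F: "finite F" "F \<subseteq> {..<?len}" "\<forall>\<alpha>\<in>F. f \<alpha> \<in> S \<alpha>" "finprod G f F = \<one>" "\<alpha> \<in> F"
      have "finprod G f F \<in> ?V (osuc \<alpha>)" unfolding F(4) by (rule subgroup.one_closed[OF V])
      then show "f \<alpha> = \<one>"
        using filtration_components_trivial[OF V V_mono S(2,3) F(1,3) _ F(5) less_osuc] by blast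
    qed (use S(1) span' in auto)
    moreover have "S \<alpha> - {\<one>} \<subseteq> ppow p G \<alpha> - ppow p G (osuc \<alpha>)" for \<alpha> using S(2,3)[of \<alpha>] by blast
    ultimately show "summable_group p G" unfolding summable_group_def by blast
  }
qed

lemma torsion_p_group_subgroup:
  assumes "subgroup L G" shows "torsion_p_group (G\<lparr>carrier := L\<rparr>) p"
proof -
  interpret L: group "G\<lparr>carrier := L\<rparr>" using assms by (rule subgroup_imp_group)
  have "comm_group (G\<lparr>carrier := L\<rparr>)"
    by (rule L.group_comm_groupI) (use subgroup.mem_carrier[OF assms] in \<open>simp add: m_comm\<close>)
  then show ?thesis
    using prime_p torsion subgroup.mem_carrier[OF assms]
    by (simp add: torsion_p_group_def torsion_p_group_axioms_def nat_pow_consistent[symmetric])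
qed

lemma free_filtration_subgroup:
  fixes V :: "'c ordinal \<Rightarrow> 'a set"
  assumes L: "subgroup L G" and V: "\<And>\<alpha>. V \<alpha> \<subseteq> L"
  shows "group.free_filtration (G\<lparr>carrier := L\<rparr>) V \<longleftrightarrow> free_filtration V"
proof -
  interpret L: group "G\<lparr>carrier := L\<rparr>" using L by (rule subgroup_imp_group)
  have "subgroup H (G\<lparr>carrier := L\<rparr>) \<longleftrightarrow> subgroup H G" if "H \<subseteq> L" for H
    using incl_subgroup[OF L] subgroup_incl[OF _ L that] by blast
  moreover have "generate (G\<lparr>carrier := L\<rparr>) (\<Union>\<alpha>. S \<alpha>) = generate G (\<Union>\<alpha>. S \<alpha>)"
    if "\<And>\<alpha>. S \<alpha> \<subseteq> L" for S :: "'c ordinal \<Rightarrow> 'a set"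
    using that by (intro generate_consistent L) blast
  ultimately have "(\<forall>\<alpha>. subgroup (S \<alpha>) (G\<lparr>carrier := L\<rparr>) \<and> S \<alpha> \<subseteq> V \<alpha> \<and> S \<alpha> \<inter> V (osuc \<alpha>) \<subseteq> {\<one>}) \<and>
      V 0 \<subseteq> generate (G\<lparr>carrier := L\<rparr>) (\<Union>\<alpha>. S \<alpha>) \<longleftrightarrow>
    (\<forall>\<alpha>. subgroup (S \<alpha>) G \<and> S \<alpha> \<subseteq> V \<alpha> \<and> S \<alpha> \<inter> V (osuc \<alpha>) \<subseteq> {\<one>}) \<and>
      V 0 \<subseteq> generate G (\<Union>\<alpha>. S \<alpha>)" for S
    using V by (smt (verit) subset_trans)
  then show ?thesis unfolding free_filtration_def L.free_filtration_def by simp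
qed

theorem summable_large_subgroup_iff:
  assumes L: "large_subgroup G L"
  shows "summable_group p G \<longleftrightarrow> summable_group p (G\<lparr>carrier := L\<rparr>)"
proof -
  let ?H = "G\<lparr>carrier := L\<rparr>"
  have sL: "subgroup L G" using L by (simp add: large_subgroup_def)
  interpret H: torsion_p_group ?H p using sL by (rule torsion_p_group_subgroup)
  define V where "V \<alpha> = ppow p G \<alpha> \<inter> soc" for \<alpha> :: "'a ordinal"
  define W where "W \<alpha> = ppow p ?H \<alpha> \<inter> soc" for \<alpha> :: "'a ordinal"
  have G: "G\<lparr>carrier := carrier G\<rparr> = G" by simp
  have HL: "ppow p ?H \<alpha> \<subseteq> L" for \<alpha> :: "'a ordinal"
  proof -
    have "ppow p ?H \<alpha> \<subseteq> ppow p ?H 0" by (rule ppow_antimono[OF H.is_monoid zero_ordinal_le])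
    then show ?thesis by simp
  qed
  have "(\<lambda>\<alpha> :: 'a ordinal. ppow p ?H \<alpha> \<inter> p_socle p ?H) = W"
  proof
    show "ppow p ?H \<alpha> \<inter> p_socle p ?H = W \<alpha>" for \<alpha> :: "'a ordinal"
      using HL[of \<alpha>] subgroup.mem_carrier[OF sL]
      by (auto simp: W_def p_socle_def nat_pow_consistent[symmetric])
  qed
  then have "summable_group p ?H \<longleftrightarrow> H.free_filtration W"
    using H.summable_iff_free_filtration by simp
  also have "\<dots> \<longleftrightarrow> free_filtration W"
    using HL by (intro free_filtration_subgroup[OF sL]) (auto simp: W_def)
  finally have "summable_group p ?H \<longleftrightarrow> free_filtration W" .
  moreover have "summable_group p G \<longleftrightarrow> free_filtration V"
    using summable_iff_free_filtration by (simp add: V_def[abs_def])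
  moreover have "free_filtration V \<longleftrightarrow> free_filtration W"
  proof -
    obtain u where u: "mono u" "\<And>k. k \<le> u k" "\<And>k. ppw k L \<inter> soc = ppw (u k) (carrier G) \<inter> soc"
      using large_subgroup_soc_sequence[OF L] by blast
    have V: "subgroup (V \<alpha>) G" for \<alpha> unfolding V_def
      using subgroup_ppow[OF subgroup_self, of \<alpha>] subgroup_soc unfolding G by (rule subgroups_Inter_pair)
    have V_mono: "\<alpha> \<le> \<beta> \<Longrightarrow> V \<beta> \<subseteq> V \<alpha>" for \<alpha> \<beta>
      using ppow_antimono[OF is_monoid] unfolding V_def by blast
    have exp: "x [^] p = \<one>" if "x \<in> V 0" for x using that by (simp add: V_def p_socle_def)
    have W_fin: "W (ofin k) = V (ofin (u k))" for k
      using ppow_ofin[OF sL, of k] ppow_ofin[OF subgroup_self, of "u k"] u(3)[of k]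
      by (simp add: V_def W_def del: ppow.simps)
    have W_inf: "W \<alpha> = V \<alpha>" if "\<alpha> \<notin> range ofin" for \<alpha>
      using ppow_infinite_eq[OF sL large_subgroup_pomega[OF L] that] by (simp add: V_def W_def)
    show ?thesis
      using free_filtration_coarsen[OF prime_p V V_mono exp u(1,2) W_fin W_inf]
        free_filtration_refine[OF prime_p V V_mono exp u(1,2) W_fin W_inf] by blast
  qed
  ultimately show ?thesis by simp
qed

end

theorem theorem5:
  fixes p :: nat and G :: "('a, 'b) monoid_scheme" and L :: "'a set"
  assumes "Factorial_Ring.prime p"
    and "abelian_p_group p G"
    and "large_subgroup G L"
  shows "summable_group p G \<longleftrightarrow> summable_group p (G\<lparr>carrier := L\<rparr>)"
proof -
  interpret comm_group G using assms(2) by (simp add: abelian_p_group_def)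
  have "\<exists>n. x [^]\<^bsub>G\<^esub> (p ^ n) = \<one>\<^bsub>G\<^esub>" if "x \<in> carrier G" for x
    using assms(2) that pow_ord_eq_1[OF that] by (metis abelian_p_group_def)
  then interpret torsion_p_group G p using assms(1) by unfold_locales
  show ?thesis using assms(3) by (rule summable_large_subgroup_iff)
qed

end
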